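(* The total regret of the Prediction Algorithm (defined in the context) over the first $T$ rounds is bounded by $O(k^4(f(T)+1)\ln(T))$. That is, there is an absolute constant $C>0$ such that the following holds for every number of arms $k$, every nondecreasing function $f$, every value vector $v^*\in[0,1]^k$, every sequence of cost vectors $c^1,c^2,\ldots\in\mathbb{R}^k$, and every sequence of agent actions $a_1,a_2,\ldots\in[k]$ whose regret satisfies $\sum_{t=1}^{\tau} ar_t\le f(\tau)$ for all $\tau\ge 1$: for every $T\ge 2$, the arms $p_1,p_2,\ldots$ picked by the Prediction Algorithm satisfy $$\sum_{t=1}^{T} pr_t\le C\,k^4\,(f(T)+1)\ln(T).$$
   Context: Setting. An agent plays a bandit game with $k$ arms, $[k]=\{1,\ldots,k\}$. In each time step $t=1,2,\ldots$ arm $i$ has a publicly observed cost $c^t_i\in\mathbb{R}$, announced at the beginning of step $t$. The reward of playing arm $i$ is drawn from a fixed distribution with expected value $v^*_i\in[0,1]$; rewards are observed only by the agent, and $v^*$ is unknown to the prediction algorithm. The optimal arm at time $t$ is $o_t\in\arg\max_{i\in[k]}\{v^*_i-c^t_i\}$. If the agent plays arm $a_t$ at time $t$, her regret at that step is $ar_t=(v^*_{o_t}-c^t_{o_t})-(v^*_{a_t}-c^t_{a_t})$. The agent is assumed to satisfy $\sum_{t=1}^{\tau} ar_t\le f(\tau)$ for every $\tau\ge1$, where $f$ is a function known to the algorithm; otherwise her strategy is arbitrary. A prediction algorithm picks at each step $t$ an arm $p_t$ based on $c^1,\ldots,c^{t}$ and $a_1,\ldots,a_{t-1}$ (not on rewards),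 and incurs regret $pr_t=(v^*_{o_t}-c^t_{o_t})-(v^*_{p_t}-c^t_{p_t})$. Consistent values. $CV(t)$ is the set of all $v\in[0,1]^k$ for which there exists a real vector $r=(r_1,\ldots,r_{t-1})$ such that $v_{a_\ell}-c^\ell_{a_\ell}\ge v_i-c^\ell_i-r_\ell$ for all $\ell\in[t-1]$ and $i\in[k]$, and $\sum_{j\le \ell} r_j\le f(\ell)$ for all $\ell\in[t-1]$. Prediction Algorithm. At each time step $t$, for each arm $i$ let $w_i=\Pr_{v\sim \mathrm{Unif}(CV(t))}[\,v_i-c^t_i\ge v_j-c^t_j\ \ \forall j\in[k]\,]$, and pick $p_t\in\arg\max_i w_i$ (ties broken arbitrarily). Here $\mathrm{Unif}(CV(t))$ is the uniform distribution on the convex set $CV(t)$ (with respect to Lebesgue measure on its affine hull if it is not full-dimensional). *)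

theory Defs
  imports "HOL-Probability.Probability"
begin

text \<open>
  The constant in the regret bound is uniform in the number of arms \<open>k\<close>, so \<open>k\<close> cannot be a type.
  A vector of \<open>\<real>\<^sup>k\<close> is an extensional function on \<open>{1..k}\<close>; the library notions tied to
  \<open>real_vector\<close> types (\<^const>\<open>affine\<close>, Lebesgue measure) are restated for this carrier.
  Time steps start at 1, and \<open>c t i\<close> is the cost of arm \<open>i\<close> at time \<open>t\<close>.
\<close>

definition rvec :: "nat \<Rightarrow> (nat \<Rightarrow> real) set" where
  "rvec k = {1..k} \<rightarrow>\<^sub>E UNIV"

definition unit_cube :: "nat \<Rightarrow> (nat \<Rightarrow> real) set" where
  "unit_cube k = {1..k} \<rightarrow>\<^sub>E {0..1}"

definition lborel_rvec :: "nat \<Rightarrow> (nat \<Rightarrow> real) measure" where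
  "lborel_rvec k = (\<Pi>\<^sub>M i\<in>{1..k}. lborel)"


subsection \<open>The uniform distribution on a subset of \<open>\<real>\<^sup>k\<close>\<close>

definition affine_rvec :: "nat \<Rightarrow> (nat \<Rightarrow> real) set \<Rightarrow> bool" where
  "affine_rvec k A \<longleftrightarrow> A \<subseteq> rvec k \<and>
     (\<forall>x\<in>A. \<forall>y\<in>A. \<forall>s t. s + t = 1 \<longrightarrow> (\<lambda>i\<in>{1..k}. s * x i + t * y i) \<in> A)"

text \<open>Orthonormal coordinates \<open>\<real>\<^sup>d \<rightarrow> \<real>\<^sup>k\<close> with origin \<open>b\<close> and directions \<open>u 1, \<dots>, u d\<close>.\<close>

definition frame_map ::
  "nat \<Rightarrow> nat \<Rightarrow> (nat \<Rightarrow> real) \<Rightarrow> (nat \<Rightarrow> nat \<Rightarrow> real) \<Rightarrow> (nat \<Rightarrow> real) \<Rightarrow> nat \<Rightarrow> real" where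
  "frame_map k d b u y = (\<lambda>i\<in>{1..k}. b i + (\<Sum>j=1..d. y j * u j i))"

definition orthonormal_frame ::
  "nat \<Rightarrow> nat \<Rightarrow> (nat \<Rightarrow> real) \<Rightarrow> (nat \<Rightarrow> nat \<Rightarrow> real) \<Rightarrow> (nat \<Rightarrow> real) set \<Rightarrow> bool" where
  "orthonormal_frame k d b u A \<longleftrightarrow>
     (\<forall>j\<in>{1..d}. \<forall>l\<in>{1..d}. (\<Sum>i=1..k. u j i * u l i) = (if j = l then 1 else 0)) \<and>
     A = frame_map k d b u ` rvec d"

text \<open>
  Lebesgue measure on a nonempty affine subspace \<open>A\<close> of \<open>\<real>\<^sup>k\<close>: the image of Lebesgue measure on
  \<open>\<real>\<^sup>d\<close>, \<open>d = dim A\<close>, under an isometric parametrization of \<open>A\<close>. Every such \<open>A\<close> has an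
  orthonormal frame, and the measure does not depend on which frame is chosen. For \<open>A = \<real>\<^sup>k\<close>
  it is ordinary Lebesgue measure; for a single point it is the Dirac measure.
\<close>

definition affine_lborel :: "nat \<Rightarrow> (nat \<Rightarrow> real) set \<Rightarrow> (nat \<Rightarrow> real) measure" where
  "affine_lborel k A =
     (SOME M. \<exists>d b u. orthonormal_frame k d b u A \<and>
        M = distr (lborel_rvec d) (lborel_rvec k) (frame_map k d b u))"

definition uniform_dist :: "nat \<Rightarrow> (nat \<Rightarrow> real) set \<Rightarrow> (nat \<Rightarrow> real) measure" where
  "uniform_dist k S = uniform_measure (affine_lborel k (affine_rvec k hull S)) S"


subsection \<open>The prediction game\<close>

definition best_arm :: "nat \<Rightarrow> (nat \<Rightarrow> real) \<Rightarrow> (nat \<Rightarrow> real) \<Rightarrow> nat \<Rightarrow> bool" where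
  "best_arm k v ct i \<longleftrightarrow> is_arg_max (\<lambda>j. v j - ct j) (\<lambda>j. j \<in> {1..k}) i"

text \<open>Regret of playing arm \<open>i\<close> instead of arm \<open>b\<close>, under costs \<open>ct\<close>.\<close>

definition regret :: "(nat \<Rightarrow> real) \<Rightarrow> (nat \<Rightarrow> real) \<Rightarrow> nat \<Rightarrow> nat \<Rightarrow> real" where
  "regret v ct b i = (v b - ct b) - (v i - ct i)"

definition CV ::
  "nat \<Rightarrow> (nat \<Rightarrow> real) \<Rightarrow> (nat \<Rightarrow> nat \<Rightarrow> real) \<Rightarrow> (nat \<Rightarrow> nat) \<Rightarrow> nat \<Rightarrow> (nat \<Rightarrow> real) set" where
  "CV k f c a t = {v \<in> unit_cube k. \<exists>r :: nat \<Rightarrow> real.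
     (\<forall>l\<in>{1..<t}. \<forall>i\<in>{1..k}. v (a l) - c l (a l) \<ge> v i - c l i - r l) \<and>
     (\<forall>l\<in>{1..<t}. (\<Sum>j=1..l. r j) \<le> f l)}"

definition weight ::
  "nat \<Rightarrow> (nat \<Rightarrow> real) \<Rightarrow> (nat \<Rightarrow> nat \<Rightarrow> real) \<Rightarrow> (nat \<Rightarrow> nat) \<Rightarrow> nat \<Rightarrow> nat \<Rightarrow> real" where
  "weight k f c a t i =
     measure (uniform_dist k (CV k f c a t))
       {v \<in> rvec k. \<forall>j\<in>{1..k}. v i - c t i \<ge> v j - c t j}"

text \<open>
  \<open>p\<close> is a possible sequence of predictions; the arbitrary tie-breaking makes this a relation.
\<close>

definition prediction_algorithm ::
  "nat \<Rightarrow> (nat \<Rightarrow> real) \<Rightarrow> (nat \<Rightarrow> nat \<Rightarrow> real) \<Rightarrow> (nat \<Rightarrow> nat) \<Rightarrow> (nat \<Rightarrow> nat) \<Rightarrow> bool" where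
  "prediction_algorithm k f c a p \<longleftrightarrow>
     (\<forall>t\<ge>1. is_arg_max (weight k f c a t) (\<lambda>i. i \<in> {1..k}) (p t))"

end

theory Submission
  imports Defs
begin

text \<open>
  The consistent set \<open>K t\<close> consists of the \<open>w\<close> in the cube under which the agent's accumulated regret
  \<open>cum l w\<close> stays within \<open>f l\<close> for all \<open>l < t\<close>; it is convex and contains \<open>v\<close>. The excess
  \<open>gap t\<close> of the prediction regret over the agent's regret is positive only if \<open>p t\<close> beats
  \<open>a t\<close> by less under \<open>v\<close> than the costs ask for, whereas at least \<open>1 / k\<close> of \<open>K t\<close> disagrees.
  Contracting \<open>K t\<close> towards \<open>v\<close> shows that \<open>1 / (2 * k)\<close> of \<open>K t\<close>, the set \<open>hit t\<close>, even disagrees by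
  a margin \<open>gap t / (2 * k\<^sup>2)\<close>, and is charged that much regret by the agent's choice.

  If the whole of \<open>hit t\<close> is removed, then the extent of \<open>K t\<close> beyond \<open>v\<close> in the direction of
  the pair \<open>(p t, a t)\<close> shrinks by a factor \<open>1 - \<Omega>(1 / k\<^sup>2)\<close>, and these gaps sum to \<open>O(k\<^sup>4)\<close> as geometric
  series. Otherwise the charges are bounded by the available budget \<open>F\<close>, and the sum of the gaps is
  \<open>O(k\<^sup>3 F)\<close> times the logarithm of the ratio of volumes.

  The volume of \<open>K t\<close> need not be bounded below, and \<open>K t\<close> may even lose dimension. Therefore
  time is cut into epochs, each lasting as long as some point of \<open>K t\<close> keeps slack \<open>1 / T\<close> in all
  constraints of the epoch. Contracting towards such a point, the volume ratio within an epoch is at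
  least \<open>(1 / (2 * T\<^sup>2)) ^ k\<close>; and once no such point is left, all of \<open>K t\<close> has used up the budget
  available at the start of the epoch, so that the budgets of the epochs sum to \<open>O(f T + 1)\<close>.
\<close>

subsection \<open>Convex and affine sets of vectors\<close>

text \<open>The homothety with centre \<open>x\<close> and ratio \<open>m\<close>, applied to
  \<open>y\<close>. Segments, lines and contractions are all expressed by it, according to the range
  of \<open>m\<close>.\<close>

definition mix :: "nat \<Rightarrow> real \<Rightarrow> (nat \<Rightarrow> real) \<Rightarrow> (nat \<Rightarrow> real) \<Rightarrow> nat \<Rightarrow> real" where
  "mix k m x y = (\<lambda>i\<in>{1..k}. (1 - m) * x i + m * y i)"

definition convex_rvec :: "nat \<Rightarrow> (nat \<Rightarrow> real) set \<Rightarrow> bool" where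
  "convex_rvec k S \<longleftrightarrow> S \<subseteq> rvec k \<and> (\<forall>x\<in>S. \<forall>y\<in>S. \<forall>m\<in>{0..1}. mix k m x y \<in> S)"

lemma mix_apply [simp]: "i \<in> {1..k} \<Longrightarrow> mix k m x y i = (1 - m) * x i + m * y i"
  by (simp add: mix_def)

lemma mix_in_rvec [simp]: "mix k m x y \<in> rvec k"
  by (simp add: mix_def rvec_def)

lemma restrict_in_rvec [simp]:
  "restrict g {1..k} \<in> rvec k" "restrict g {Suc 0..k} \<in> rvec k"
  by (simp_all add: rvec_def)

lemma rvec_eqI:
  assumes "x \<in> rvec k" "y \<in> rvec k" "\<And>i. i \<in> {1..k} \<Longrightarrow> x i = y i"
  shows "x = y"
  using assms unfolding rvec_def by (intro PiE_ext) auto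

lemma affine_rvec_iff_mix:
  "affine_rvec k A \<longleftrightarrow> A \<subseteq> rvec k \<and> (\<forall>x\<in>A. \<forall>y\<in>A. \<forall>m. mix k m x y \<in> A)"
proof -
  have "(\<forall>s t. s + t = 1 \<longrightarrow> (\<lambda>i\<in>{1..k}. s * x i + t * y i) \<in> A) \<longleftrightarrow> (\<forall>m. mix k m x y \<in> A)"
    for x y
  proof
    assume *: "\<forall>s t. s + t = 1 \<longrightarrow> (\<lambda>i\<in>{1..k}. s * x i + t * y i) \<in> A"
    show "\<forall>m. mix k m x y \<in> A"
      using * by (auto simp: mix_def)
  next
    assume *: "\<forall>m. mix k m x y \<in> A"
    show "\<forall>s t. s + t = 1 \<longrightarrow> (\<lambda>i\<in>{1..k}. s * x i + t * y i) \<in> A"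
    proof (intro allI impI)
      fix s t :: real assume "s + t = 1"
      then have "s = 1 - t" by simp
      then show "(\<lambda>i\<in>{1..k}. s * x i + t * y i) \<in> A"
        using * unfolding mix_def by blast
    qed
  qed
  then show ?thesis by (simp add: affine_rvec_def)
qed

lemma affine_rvec_mixD:
  "affine_rvec k A \<Longrightarrow> x \<in> A \<Longrightarrow> y \<in> A \<Longrightarrow> mix k m x y \<in> A"
  by (simp add: affine_rvec_iff_mix)

lemma affine_rvec_subset: "affine_rvec k A \<Longrightarrow> A \<subseteq> rvec k"
  by (simp add: affine_rvec_def)

lemma affine_rvec_rvec: "affine_rvec k (rvec k)"
  by (simp add: affine_rvec_iff_mix)

lemma affine_rvec_hull:
  assumes "S \<subseteq> rvec k"
  shows "affine_rvec k (affine_rvec k hull S)"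
proof (rule affine_rvec_iff_mix[THEN iffD2], intro conjI ballI allI)
  show "affine_rvec k hull S \<subseteq> rvec k"
    by (rule hull_minimal) (use assms affine_rvec_rvec in auto)
  fix x y and m :: real assume "x \<in> affine_rvec k hull S" "y \<in> affine_rvec k hull S"
  then show "mix k m x y \<in> affine_rvec k hull S"
    unfolding hull_def by (auto intro: affine_rvec_mixD)
qed

text \<open>The point \<open>z + s (x - w)\<close> is the midpoint of a point on the line through
  \<open>z\<close> and \<open>x\<close> and a point on the line through \<open>z\<close> and
  \<open>w\<close>.\<close>

lemma affine_rvec_translate:
  assumes A: "affine_rvec k A" and mem: "z \<in> A" "x \<in> A" "w \<in> A"
  shows "(\<lambda>i\<in>{1..k}. z i + s * (x i - w i)) \<in> A"
proof -
  have "mix k (1/2) (mix k (2 * s) z x) (mix k (- 2 * s) z w) \<in> A"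
    using A mem by (intro affine_rvec_mixD)
  also have "mix k (1/2) (mix k (2 * s) z x) (mix k (- 2 * s) z w) = (\<lambda>i\<in>{1..k}. z i + s * (x i - w i))"
    by (intro rvec_eqI[of _ k]) (auto simp: field_simps)
  finally show ?thesis .
qed

subsection \<open>Frames\<close>

lemma frame_map_apply: "i \<in> {1..k} \<Longrightarrow> frame_map k d b u y i = b i + (\<Sum>j=1..d. y j * u j i)"
  by (simp add: frame_map_def)

lemma frame_map_in_rvec [simp]: "frame_map k d b u y \<in> rvec k"
  by (simp add: frame_map_def rvec_def)

lemma frame_map_mix: "frame_map k d b u (mix d m x y) = mix k m (frame_map k d b u x) (frame_map k d b u y)"
proof (rule rvec_eqI)
  fix i assume i: "i \<in> {1..k}"
  have "(\<Sum>j=1..d. mix d m x y j * u j i)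
      = (\<Sum>j=1..d. (1 - m) * (x j * u j i) + m * (y j * u j i))"
    by (intro sum.cong) (auto simp: algebra_simps)
  also have "\<dots> = (1 - m) * (\<Sum>j=1..d. x j * u j i) + m * (\<Sum>j=1..d. y j * u j i)"
    by (simp add: sum.distrib sum_distrib_left)
  finally show "frame_map k d b u (mix d m x y) i = mix k m (frame_map k d b u x) (frame_map k d b u y) i"
    using i by (simp add: frame_map_apply algebra_simps)
qed auto

text \<open>The orthonormality half of \<open>orthonormal_frame\<close>, separated from the
  condition on the image so that partial frames can be extended.\<close>

definition orthonormal_on :: "nat \<Rightarrow> nat \<Rightarrow> (nat \<Rightarrow> nat \<Rightarrow> real) \<Rightarrow> bool" where
  "orthonormal_on k d u \<longleftrightarrow>
     (\<forall>j\<in>{1..d}. \<forall>l\<in>{1..d}. (\<Sum>i=1..k. u j i * u l i) = (if j = l then 1 else 0))"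

lemma orthonormal_coord:
  assumes "orthonormal_on k d u" "j \<in> {1..d}"
  shows "(\<Sum>i=1..k. (\<Sum>l=1..d. y l * u l i) * u j i) = y j"
proof -
  have "(\<Sum>i=1..k. (\<Sum>l=1..d. y l * u l i) * u j i) = (\<Sum>i=1..k. \<Sum>l=1..d. y l * (u l i * u j i))"
    by (simp add: sum_distrib_right mult.assoc)
  also have "\<dots> = (\<Sum>l=1..d. y l * (\<Sum>i=1..k. u l i * u j i))"
    by (subst sum.swap) (simp add: sum_distrib_left)
  also have "\<dots> = (\<Sum>l=1..d. y l * (if l = j then 1 else 0))"
    using assms unfolding orthonormal_on_def by (intro sum.cong) auto
  also have "\<dots> = y j"
    using assms(2) by (simp add: if_distrib cong: if_cong)
  finally show ?thesis .
qed

lemma frame_map_coord: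
  assumes "orthonormal_on k d u" "j \<in> {1..d}"
  shows "y j = (\<Sum>i=1..k. (frame_map k d b u y i - b i) * u j i)"
proof -
  have "(\<Sum>i=1..k. (frame_map k d b u y i - b i) * u j i)
      = (\<Sum>i=1..k. (\<Sum>l=1..d. y l * u l i) * u j i)"
    by (intro sum.cong) (auto simp: frame_map_apply)
  then show ?thesis using orthonormal_coord[OF assms] by simp
qed

text \<open>The squared entries of \<open>u\<close> sum to \<open>d\<close> vector by vector.
  Coordinate by coordinate they sum to at most \<open>k\<close>, because by Bessel no standard unit
  vector has a projection longer than 1.\<close>

lemma orthonormal_on_le:
  assumes "orthonormal_on k d u"
  shows "d \<le> k"
proof -
  have bessel: "(\<Sum>j=1..d. (u j i)\<^sup>2) \<le> 1" if i: "i \<in> {1..k}" for i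
  proof -
    define s where "s = (\<Sum>j=1..d. (u j i)\<^sup>2)"
    \<comment> \<open>\<open>w\<close> is the projection of the \<open>i\<close>-th unit vector onto
      the span of the \<open>u j\<close>. Both its squared length and its \<open>i\<close>-th entry
      equal \<open>s\<close>, whence \<open>s * s \<le> s\<close>.\<close>
    define w where "w l = (\<Sum>j=1..d. u j i * u j l)" for l
    have wi: "w i = s" by (simp add: w_def s_def power2_eq_square)
    have "(\<Sum>l=1..k. (w l)\<^sup>2) = (\<Sum>l=1..k. \<Sum>j=1..d. u j i * (w l * u j l))"
      by (simp add: w_def power2_eq_square sum_distrib_left sum_distrib_right algebra_simps)
    also have "\<dots> = (\<Sum>j=1..d. u j i * (\<Sum>l=1..k. w l * u j l))"
      by (subst sum.swap) (simp add: sum_distrib_left)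
    also have "\<dots> = (\<Sum>j=1..d. u j i * u j i)"
      using orthonormal_coord[OF assms, where y = "\<lambda>j. u j i"]
      by (intro sum.cong) (auto simp: w_def)
    finally have ww: "(\<Sum>l=1..k. (w l)\<^sup>2) = s" by (simp add: s_def power2_eq_square)
    have "(w i)\<^sup>2 \<le> (\<Sum>l=1..k. (w l)\<^sup>2)"
      using i by (intro member_le_sum) auto
    then have "s * s \<le> s" using wi ww by (simp add: power2_eq_square)
    moreover have "s \<ge> 0" by (simp add: s_def sum_nonneg)
    ultimately show ?thesis unfolding s_def[symmetric]
      using mult_le_cancel_left_pos[of s s 1] by (cases "s = 0") auto
  qed
  have "real d = (\<Sum>j=1..d. \<Sum>i=1..k. (u j i)\<^sup>2)"
    using assms by (simp add: orthonormal_on_def power2_eq_square)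
  also have "\<dots> = (\<Sum>i=1..k. \<Sum>j=1..d. (u j i)\<^sup>2)" by (rule sum.swap)
  also have "\<dots> \<le> (\<Sum>i=1..k. 1)" by (intro sum_mono bessel)
  finally show ?thesis by simp
qed

text \<open>A largest orthonormal system that maps into \<open>A\<close> already covers
  \<open>A\<close>: a point outside its image would yield one more direction by Gram-Schmidt. Sizes
  are bounded by \<open>k\<close>.\<close>

lemma orthonormal_frame_exists:
  assumes A: "affine_rvec k A" and ne: "A \<noteq> {}"
  shows "\<exists>d b u. orthonormal_frame k d b u A"
proof -
  define P where "P d \<longleftrightarrow> (\<exists>b u. orthonormal_on k d u \<and> frame_map k d b u ` rvec d \<subseteq> A)" for d
  obtain x0 where x0: "x0 \<in> A" using ne by blast
  have "frame_map k 0 x0 (\<lambda>_ _. 0) y = x0" for y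
    using x0 affine_rvec_subset[OF A] by (intro rvec_eqI[of _ k]) (auto simp: frame_map_apply)
  then have P0: "P 0" using x0 unfolding P_def orthonormal_on_def by (auto intro!: exI[of _ x0] exI[of _ "\<lambda>_ _. 0"])
  have Pk: "P d \<Longrightarrow> d \<le> k" for d
    unfolding P_def using orthonormal_on_le by blast
  define d where "d = Greatest P"
  have Pd: "P d" unfolding d_def using GreatestI_nat[of P 0 k] P0 Pk by blast
  have dmax: "\<not> P (Suc d)"
    using Greatest_le_nat[of P "Suc d" k] Pk unfolding d_def by fastforce
  obtain b u where on: "orthonormal_on k d u" and sub: "frame_map k d b u ` rvec d \<subseteq> A"
    using Pd unfolding P_def by blast
  have "A \<subseteq> frame_map k d b u ` rvec d"
  proof (rule ccontr)
    assume "\<not> ?thesis"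
    then obtain x where x: "x \<in> A" "x \<notin> frame_map k d b u ` rvec d" by blast
    \<comment> \<open>\<open>w\<close> is the orthogonal projection of \<open>x\<close> onto the
      image of the frame. The residual \<open>r\<close>, divided by its length
      \<open>\<rho>\<close>, becomes the new direction.\<close>
    define \<xi> where "\<xi> = (\<lambda>j\<in>{1..d}. \<Sum>i=1..k. (x i - b i) * u j i)"
    define w where "w = frame_map k d b u \<xi>"
    have \<xi>: "\<xi> \<in> rvec d" by (simp add: \<xi>_def rvec_def)
    then have wA: "w \<in> A" using sub by (auto simp: w_def)
    define r where "r i = x i - w i" for i
    define \<rho> where "\<rho> = sqrt (\<Sum>i=1..k. (r i)\<^sup>2)"
    have "x \<noteq> w" using x \<xi> by (auto simp: w_def)
    then obtain i where i: "i \<in> {1..k}" "r i \<noteq> 0"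
      using rvec_eqI[of x k w] x(1) wA affine_rvec_subset[OF A] by (auto simp: r_def)
    have "(\<Sum>i=1..k. (r i)\<^sup>2) > 0"
      using i by (intro sum_pos2[of _ i]) auto
    then have \<rho>: "\<rho> > 0" "\<rho> * \<rho> = (\<Sum>i=1..k. r i * r i)"
      by (auto simp: \<rho>_def power2_eq_square)
    have orth: "(\<Sum>i=1..k. r i * u j i) = 0" if j: "j \<in> {1..d}" for j
    proof -
      have "\<xi> j = (\<Sum>i=1..k. (w i - b i) * u j i)"
        unfolding w_def by (rule frame_map_coord[OF on j])
      moreover have "\<xi> j = (\<Sum>i=1..k. (x i - b i) * u j i)"
        using j by (simp add: \<xi>_def)
      moreover have "(\<Sum>i=1..k. r i * u j i)
          = (\<Sum>i=1..k. (x i - b i) * u j i) - (\<Sum>i=1..k. (w i - b i) * u j i)"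
        by (simp add: r_def sum_subtractf[symmetric] algebra_simps)
      ultimately show ?thesis by simp
    qed
    define u' where "u' = u(Suc d := (\<lambda>i. r i / \<rho>))"
    have o1: "(\<Sum>i=1..k. u j i * (r i / \<rho>)) = 0" "(\<Sum>i=1..k. (r i / \<rho>) * u j i) = 0"
      if "j \<in> {1..d}" for j
      using orth[OF that] by (simp_all add: sum_divide_distrib[symmetric] mult.commute)
    have "(\<Sum>i=1..k. (r i / \<rho>) * (r i / \<rho>)) = (\<Sum>i=1..k. r i * r i) / (\<rho> * \<rho>)"
      by (simp add: sum_divide_distrib)
    then have o2: "(\<Sum>i=1..k. (r i / \<rho>) * (r i / \<rho>)) = 1"
      using \<rho>(1) unfolding \<rho>(2)[symmetric] by simp
    have on': "orthonormal_on k (Suc d) u'"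
      unfolding orthonormal_on_def
    proof (intro ballI)
      fix j l assume "j \<in> {1..Suc d}" "l \<in> {1..Suc d}"
      then have j: "j \<in> {1..d} \<or> j = Suc d" and l: "l \<in> {1..d} \<or> l = Suc d" by auto
      show "(\<Sum>i=1..k. u' j i * u' l i) = (if j = l then 1 else 0)"
        using j l o1 o2 on by (auto simp: u'_def orthonormal_on_def)
    qed
    have "frame_map k (Suc d) b u' ` rvec (Suc d) \<subseteq> A"
    proof safe
      fix y :: "nat \<Rightarrow> real"
      define y' where "y' = restrict y {1..d}"
      have zA: "frame_map k d b u y' \<in> A"
        using sub by (auto simp: y'_def rvec_def)
      have "(\<lambda>i\<in>{1..k}. frame_map k d b u y' i + (y (Suc d) / \<rho>) * (x i - w i)) \<in> A"
        by (rule affine_rvec_translate[OF A zA x(1) wA])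
      also have "(\<lambda>i\<in>{1..k}. frame_map k d b u y' i + (y (Suc d) / \<rho>) * (x i - w i))
          = frame_map k (Suc d) b u' y"
      proof (rule rvec_eqI[of _ k])
        fix i assume i: "i \<in> {1..k}"
        have "(\<Sum>j=1..d. y' j * u j i) = (\<Sum>j=1..d. y j * u' j i)"
          by (intro sum.cong) (auto simp: y'_def u'_def)
        then show "(\<lambda>i\<in>{1..k}. frame_map k d b u y' i + (y (Suc d) / \<rho>) * (x i - w i)) i
            = frame_map k (Suc d) b u' y i"
          using i by (simp add: frame_map_apply u'_def r_def)
      qed auto
      finally show "frame_map k (Suc d) b u' y \<in> A" .
    qed
    then show False using on' dmax unfolding P_def by blast
  qed
  then show ?thesis
    using on sub unfolding orthonormal_frame_def orthonormal_on_def by blast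
qed

subsection \<open>Points in the affine hull of a convex set\<close>

text \<open>
  The segment from some point of the convex set towards \<open>x\<close> starts inside the set. These \<open>x\<close>
  form an affine set, hence contain the hull, and one starting point serves finitely many \<open>x\<close>.
\<close>

definition reachable_from :: "nat \<Rightarrow> (nat \<Rightarrow> real) set \<Rightarrow> (nat \<Rightarrow> real) \<Rightarrow> real \<Rightarrow> (nat \<Rightarrow> real) \<Rightarrow> bool" where
  "reachable_from k S q m x \<longleftrightarrow> q \<in> S \<and> 0 < m \<and> m \<le> 1 \<and> mix k m q x \<in> S"

lemma convex_rvec_mixD:
  "convex_rvec k S \<Longrightarrow> x \<in> S \<Longrightarrow> y \<in> S \<Longrightarrow> 0 \<le> m \<Longrightarrow> m \<le> 1 \<Longrightarrow> mix k m x y \<in> S"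
  by (simp add: convex_rvec_def)

lemma convex_rvec_3:
  assumes S: "convex_rvec k S" and mem: "x \<in> S" "y \<in> S" "z \<in> S"
    and c: "\<alpha> \<ge> 0" "\<beta> \<ge> 0" "\<gamma> \<ge> 0" "\<alpha> + \<beta> + \<gamma> = 1"
  shows "(\<lambda>i\<in>{1..k}. \<alpha> * x i + \<beta> * y i + \<gamma> * z i) \<in> S"
proof (cases "\<alpha> + \<beta> = 0")
  case True
  then have "\<alpha> = 0" "\<beta> = 0" "\<gamma> = 1" using c by auto
  moreover have "(\<lambda>i\<in>{1..k}. z i) = z"
    using mem S by (intro rvec_eqI[of _ k]) (auto simp: rvec_def convex_rvec_def)
  ultimately show ?thesis using mem by simp
next
  case False
  then have p: "\<alpha> + \<beta> > 0" using c by simp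
  have "mix k \<gamma> (mix k (\<beta> / (\<alpha> + \<beta>)) x y) z \<in> S"
    using p c by (intro convex_rvec_mixD[OF S] mem) auto
  also have "mix k \<gamma> (mix k (\<beta> / (\<alpha> + \<beta>)) x y) z = (\<lambda>i\<in>{1..k}. \<alpha> * x i + \<beta> * y i + \<gamma> * z i)"
  proof (rule rvec_eqI[of _ k])
    fix i assume i: "i \<in> {1..k}"
    have g: "1 - \<gamma> = \<alpha> + \<beta>" using c by simp
    define h where "h = \<alpha> + \<beta>"
    have h: "h > 0" "\<alpha> = h - \<beta>" using p by (auto simp: h_def)
    have "(\<alpha> + \<beta>) * ((1 - \<beta> / (\<alpha> + \<beta>)) * x i + \<beta> / (\<alpha> + \<beta>) * y i) = \<alpha> * x i + \<beta> * y i"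
      unfolding h_def[symmetric] h(2) using h(1) by (simp add: field_simps)
    then show "mix k \<gamma> (mix k (\<beta> / (\<alpha> + \<beta>)) x y) z i = (\<lambda>i\<in>{1..k}. \<alpha> * x i + \<beta> * y i + \<gamma> * z i) i"
      unfolding mix_apply[OF i] g using i by simp
  qed auto
  finally show ?thesis .
qed

text \<open>This allows two starting points to be replaced by their midpoint. The new point is a
  combination of \<open>mix k m q x\<close>, \<open>q\<close> and \<open>q'\<close>, and
  \<open>n \<le> m / 3\<close> keeps the weight of \<open>q\<close> nonnegative.\<close>

lemma reachable_from_move:
  assumes S: "convex_rvec k S" and r: "reachable_from k S q m x" and q': "q' \<in> S"
    and n: "0 < n" "n \<le> m / 3"
  shows "reachable_from k S (mix k (1/2) q q') n x"
proof -
  let ?p = "mix k m q x"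
  have m: "q \<in> S" "0 < m" "m \<le> 1" "?p \<in> S" using r by (auto simp: reachable_from_def)
  have n3: "3 * n \<le> m" using n by simp
  have 1: "n / m \<ge> 0" "(1 - n) / 2 \<ge> 0" using n m by auto
  have "n / m \<le> 1/3" using n m by (simp add: field_simps)
  moreover have "n * (1 - m) / m = n / m - n" using m by (simp add: field_simps)
  ultimately have 2: "(1 - n) / 2 - n * (1 - m) / m \<ge> 0" using n by argo
  have 3: "n / m + ((1 - n) / 2 - n * (1 - m) / m) + (1 - n) / 2 = 1"
    using m by (simp add: field_simps)
  have "(\<lambda>i\<in>{1..k}. n / m * ?p i + ((1 - n) / 2 - n * (1 - m) / m) * q i + (1 - n) / 2 * q' i) \<in> S"
    by (rule convex_rvec_3[OF S m(4) m(1) q' 1(1) 2 1(2) 3])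
  also have "(\<lambda>i\<in>{1..k}. n / m * ?p i + ((1 - n) / 2 - n * (1 - m) / m) * q i + (1 - n) / 2 * q' i)
      = mix k n (mix k (1/2) q q') x"
    using m by (intro rvec_eqI[of _ k]) (auto simp: field_simps)
  finally show ?thesis
    using n m q' by (auto simp: reachable_from_def intro: convex_rvec_mixD[OF S])
qed

lemma mix_swap_half: "mix k (1/2) q q' = mix k (1/2) q' q"
  by (intro rvec_eqI[of _ k]) auto

lemma reachable_from_finite:
  assumes S: "convex_rvec k S" and ne: "S \<noteq> {}" and fin: "finite X"
    and X: "\<And>x. x \<in> X \<Longrightarrow> \<exists>q m. reachable_from k S q m x"
  shows "\<exists>q m. q \<in> S \<and> 0 < m \<and> m \<le> 1 \<and> (\<forall>x\<in>X. reachable_from k S q m x)"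
  using fin X
proof (induction X)
  case empty
  then show ?case using ne by (auto intro!: exI[of _ "1::real"])
next
  case (insert x X)
  obtain q m where qm: "q \<in> S" "0 < m" "m \<le> 1" "\<forall>x\<in>X. reachable_from k S q m x"
    using insert by auto
  obtain q' m' where qm': "reachable_from k S q' m' x"
    using insert.prems by blast
  have q': "q' \<in> S" "0 < m'" using qm' by (auto simp: reachable_from_def)
  define n where "n = min m m' / 3"
  have n: "0 < n" "n \<le> m / 3" "n \<le> m' / 3" using qm q' by (auto simp: n_def)
  have "reachable_from k S (mix k (1/2) q q') n x"
    using reachable_from_move[OF S qm' qm(1) n(1) n(3)] by (simp only: mix_swap_half[of k q q'])
  then have "\<forall>y\<in>insert x X. reachable_from k S (mix k (1/2) q q') n y"
    using reachable_from_move[OF S _ q'(1) n(1) n(2)] qm(4) by blast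
  moreover have "mix k (1/2) q q' \<in> S" using qm q' by (intro convex_rvec_mixD[OF S]) auto
  moreover have "n \<le> 1" using n qm by simp
  ultimately show ?case using n by blast
qed

text \<open>Near the barycentre of three points all weights are close to 1/3, so a small step in any
  affine direction keeps them nonnegative.\<close>

lemma small_coeff:
  fixes a :: real
  shows "0 < n \<Longrightarrow> n * (1 + \<bar>a\<bar> * 3) \<le> 1 \<Longrightarrow> (1 - n) / 3 + n * a \<ge> 0"
proof -
  assume n: "0 < n" and le: "n * (1 + \<bar>a\<bar> * 3) \<le> 1"
  have "n * a \<ge> - (n * \<bar>a\<bar>)" using n mult_left_mono[of "- \<bar>a\<bar>" a n] by simp
  moreover have "n + 3 * (n * \<bar>a\<bar>) \<le> 1" using le by (simp add: algebra_simps)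
  ultimately show ?thesis using n by argo
qed

lemma hull_reachable:
  assumes S: "convex_rvec k S" and x: "x \<in> affine_rvec k hull S"
  shows "\<exists>q m. reachable_from k S q m x"
proof -
  let ?E = "{x \<in> rvec k. \<exists>q m. reachable_from k S q m x}"
  have SR: "S \<subseteq> rvec k" using S by (simp add: convex_rvec_def)
  have "S \<subseteq> ?E"
  proof
    fix x assume "x \<in> S"
    then have "reachable_from k S x 1 x"
      using convex_rvec_mixD[OF S, of x x 1] by (simp add: reachable_from_def)
    then show "x \<in> ?E" using \<open>x \<in> S\<close> SR by blast
  qed
  moreover have "affine_rvec k ?E"
    unfolding affine_rvec_iff_mix
  proof (intro conjI ballI allI)
    fix x x' t assume "x \<in> ?E" "x' \<in> ?E"
    then have ex: "y \<in> {x, x'} \<Longrightarrow> \<exists>q m. reachable_from k S q m y" for y by auto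
    have "S \<noteq> {}" using ex by (auto simp: reachable_from_def)
    from reachable_from_finite[OF S this, of "{x, x'}"] ex obtain q m where
      "q \<in> S" "0 < m" "m \<le> 1" "\<forall>y\<in>{x, x'}. reachable_from k S q m y"
      by (metis finite.emptyI finite.insertI)
    then have m: "q \<in> S" "0 < m" "m \<le> 1" and
      p: "mix k m q x \<in> S" "mix k m q x' \<in> S"
      by (auto simp: reachable_from_def)
    let ?p = "mix k m q x" and ?p' = "mix k m q x'"
    \<comment> \<open>The affine coordinates of \<open>mix k t x x'\<close> with respect to
      \<open>?p\<close>, \<open>?p'\<close> and \<open>q\<close>, obtained by solving the two
      homotheties for \<open>x\<close> and \<open>x'\<close>.\<close>
    define a b e where "a = (1 - t) / m" and "b = t / m" and "e = - ((1 - m) / m)"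
    define C where "C = 1 + (\<bar>a\<bar> + \<bar>b\<bar> + \<bar>e\<bar>) * 3"
    define n where "n = 1 / C"
    have C: "C \<ge> 1" by (simp add: C_def)
    have n: "0 < n" "n \<le> 1" using C by (auto simp: n_def)
    have le: "n * (1 + \<bar>h\<bar> * 3) \<le> 1" if "h \<in> {a, b, e}" for h
      using that C by (auto simp: n_def C_def)
    have co: "(1 - n) / 3 + n * a \<ge> 0" "(1 - n) / 3 + n * b \<ge> 0" "(1 - n) / 3 + n * e \<ge> 0"
      by (rule small_coeff[OF n(1) le], simp)+
    have "a + b + e = 1" using m by (simp add: a_def b_def e_def field_simps)
    then have "n * a + n * b + n * e = n" by (simp add: distrib_left[symmetric])
    then have su: "((1 - n) / 3 + n * a) + ((1 - n) / 3 + n * b) + ((1 - n) / 3 + n * e) = 1" by argo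
    \<comment> \<open>The new starting point is the barycentre of the three points. Moving a
      fraction \<open>n\<close> towards the target changes the weights to
      \<open>(1 - n) / 3 + n * a\<close> and so on.\<close>
    define q2 where "q2 = (\<lambda>i\<in>{1..k}. 1/3 * ?p i + 1/3 * ?p' i + 1/3 * q i)"
    have q2: "q2 \<in> S" unfolding q2_def by (rule convex_rvec_3[OF S p m(1)]) auto
    have "(\<lambda>i\<in>{1..k}. ((1 - n) / 3 + n * a) * ?p i + ((1 - n) / 3 + n * b) * ?p' i
        + ((1 - n) / 3 + n * e) * q i) \<in> S"
      by (rule convex_rvec_3[OF S p m(1) co su])
    also have "(\<lambda>i\<in>{1..k}. ((1 - n) / 3 + n * a) * ?p i + ((1 - n) / 3 + n * b) * ?p' i
        + ((1 - n) / 3 + n * e) * q i) = mix k n q2 (mix k t x x')"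
    proof (rule rvec_eqI[of _ k])
      fix i assume i: "i \<in> {1..k}"
      have "a * ?p i + b * ?p' i + e * q i = mix k t x x' i"
        using i m by (simp add: a_def b_def e_def field_simps)
      then have "n * (a * ?p i + b * ?p' i + e * q i) = n * mix k t x x' i" by simp
      then show "(\<lambda>i\<in>{1..k}. ((1 - n) / 3 + n * a) * ?p i + ((1 - n) / 3 + n * b) * ?p' i
        + ((1 - n) / 3 + n * e) * q i) i = mix k n q2 (mix k t x x') i"
        unfolding mix_apply[OF i, of n]
        using i by (simp add: q2_def algebra_simps del: mix_apply)
    qed auto
    finally have "reachable_from k S q2 n (mix k t x x')"
      using q2 n by (simp add: reachable_from_def)
    then show "mix k t x x' \<in> ?E" by auto
  qed auto
  ultimately have "affine_rvec k hull S \<subseteq> ?E" by (rule hull_minimal)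
  then show ?thesis using x by auto
qed

subsection \<open>Lebesgue measure on an affine hull\<close>

interpretation lborel_product: product_sigma_finite "\<lambda>_::nat. lborel :: real measure"
  by standard

lemma space_lborel_rvec [simp]: "space (lborel_rvec k) = rvec k"
  by (simp add: lborel_rvec_def rvec_def space_PiM)

lemma measurable_rvecI:
  assumes "\<And>x. x \<in> space M \<Longrightarrow> h x \<in> rvec k"
    and "\<And>i. i \<in> {1..k} \<Longrightarrow> (\<lambda>x. h x i) \<in> borel_measurable M"
  shows "h \<in> M \<rightarrow>\<^sub>M lborel_rvec k"
  unfolding lborel_rvec_def
proof (rule measurable_PiM_single')
  show "(\<lambda>x. h x i) \<in> M \<rightarrow>\<^sub>M lborel" if "i \<in> {1..k}" for i
    using assms(2)[OF that] by simp
  show "h \<in> space M \<rightarrow> {1..k} \<rightarrow>\<^sub>E space lborel"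
    using assms(1) by (auto simp: rvec_def)
qed

lemma measurable_rvec_component [measurable]:
  "i \<in> {1..k} \<Longrightarrow> (\<lambda>x. x i) \<in> borel_measurable (lborel_rvec k)"
  unfolding lborel_rvec_def
  using measurable_component_singleton[of i "{1..k}" "\<lambda>_. lborel :: real measure"] by simp

lemma measurable_mix [measurable]: "mix d m z \<in> lborel_rvec d \<rightarrow>\<^sub>M lborel_rvec d"
proof (rule measurable_rvecI)
  fix i assume i: "i \<in> {1..d}"
  then have [measurable]: "(\<lambda>x. x i) \<in> borel_measurable (lborel_rvec d)"
    by (rule measurable_rvec_component)
  show "(\<lambda>x. mix d m z x i) \<in> borel_measurable (lborel_rvec d)"
    unfolding mix_apply[OF i] by measurable
qed simp

lemma measurable_frame_map [measurable]: "frame_map k d b u \<in> lborel_rvec d \<rightarrow>\<^sub>M lborel_rvec k"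
proof (rule measurable_rvecI)
  fix i assume i: "i \<in> {1..k}"
  have [measurable]: "(\<lambda>x. x j) \<in> borel_measurable (lborel_rvec d)" if "j \<in> {1..d}" for j
    using that by (rule measurable_rvec_component)
  show "(\<lambda>x. frame_map k d b u x i) \<in> borel_measurable (lborel_rvec d)"
    unfolding frame_map_apply[OF i] by measurable
qed simp

lemma emeasure_lborel_box:
  "(\<And>i. i \<in> {1..d} \<Longrightarrow> B i \<in> sets borel) \<Longrightarrow>
    emeasure (lborel_rvec d) (Pi\<^sub>E {1..d} B) = (\<Prod>i\<in>{1..d}. emeasure lborel (B i))"
  unfolding lborel_rvec_def by (rule lborel_product.emeasure_PiM) auto

text \<open>A homothety of ratio \<open>m\<close> scales \<open>d\<close>-dimensional volume by
  \<open>m ^ d\<close>. The rescaled image measure \<open>P\<close> agrees with the product measure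
  on boxes, where the one-dimensional rule applies to each side.\<close>

lemma emeasure_mix_vimage:
  assumes m: "m > 0" and B: "B \<in> sets (lborel_rvec d)"
  shows "ennreal (m ^ d) * emeasure (lborel_rvec d) {y \<in> rvec d. mix d m z y \<in> B}
       = emeasure (lborel_rvec d) B"
proof -
  define P where "P = distr (scale_measure (ennreal (m ^ d)) (lborel_rvec d)) (lborel_rvec d) (mix d m z)"
  have em: "emeasure P S = ennreal (m ^ d) * emeasure (lborel_rvec d) {y \<in> rvec d. mix d m z y \<in> S}"
    if "S \<in> sets (lborel_rvec d)" for S
  proof -
    have "mix d m z \<in> scale_measure (ennreal (m ^ d)) (lborel_rvec d) \<rightarrow>\<^sub>M lborel_rvec d"
      using measurable_mix by simp
    then have "emeasure P S = ennreal (m ^ d) * emeasure (lborel_rvec d) (mix d m z -` S \<inter> rvec d)"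
      unfolding P_def using that by (simp add: emeasure_distr space_scale_measure)
    also have "mix d m z -` S \<inter> rvec d = {y \<in> rvec d. mix d m z y \<in> S}" by auto
    finally show ?thesis .
  qed
  have "P = (\<Pi>\<^sub>M i\<in>{1..d}. lborel)"
  proof (rule lborel_product.PiM_eqI)
    show "sets P = sets (\<Pi>\<^sub>M i\<in>{1..d}. lborel)" by (simp add: P_def lborel_rvec_def)
    fix A :: "nat \<Rightarrow> real set" assume A: "\<And>i. i \<in> {1..d} \<Longrightarrow> A i \<in> sets lborel"
    let ?A = "\<lambda>i. (\<lambda>x. (1 - m) * z i + m * x) -` A i"
    have A': "?A i \<in> sets borel" if "i \<in> {1..d}" for i
    proof -
      have "(\<lambda>x. (1 - m) * z i + m * x) -` A i \<inter> space (borel :: real measure) \<in> sets borel"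
        by (rule measurable_sets[where A = "borel :: real measure"]) (use A[OF that] in simp_all)
      then show ?thesis by simp
    qed
    have aff: "emeasure lborel (A i) = ennreal m * emeasure lborel (?A i)" if "i \<in> {1..d}" for i
    proof -
      have "emeasure lborel (A i) = emeasure (density (distr lborel borel (\<lambda>x. (1 - m) * z i + m * x)) (\<lambda>_. ennreal \<bar>m\<bar>)) (A i)"
        using lborel_real_affine[of m "(1 - m) * z i"] m by simp
      also have "\<dots> = ennreal m * emeasure lborel (?A i)"
        using A[OF that] m by (simp add: emeasure_density_const emeasure_distr)
      finally show ?thesis .
    qed
    have "Pi\<^sub>E {1..d} A \<in> sets (lborel_rvec d)"
      unfolding lborel_rvec_def using A by (intro sets_PiM_I_finite) auto
    then have "emeasure P (Pi\<^sub>E {1..d} A)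
      = ennreal (m ^ d) * emeasure (lborel_rvec d) {y \<in> rvec d. mix d m z y \<in> Pi\<^sub>E {1..d} A}"
      by (rule em)
    also have "{y \<in> rvec d. mix d m z y \<in> Pi\<^sub>E {1..d} A} = Pi\<^sub>E {1..d} ?A"
      by (auto simp: rvec_def mix_def PiE_iff extensional_def)
    also have "emeasure (lborel_rvec d) (Pi\<^sub>E {1..d} ?A) = (\<Prod>i\<in>{1..d}. emeasure lborel (?A i))"
      by (rule emeasure_lborel_box) (rule A')
    also have "ennreal (m ^ d) * \<dots> = (\<Prod>i\<in>{1..d}. ennreal m * emeasure lborel (?A i))"
      using m by (simp add: prod.distrib ennreal_power)
    also have "\<dots> = (\<Prod>i\<in>{1..d}. emeasure lborel (A i))"
      using aff by (intro prod.cong) auto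
    finally show "emeasure P (Pi\<^sub>E {1..d} A) = (\<Prod>i\<in>{1..d}. emeasure lborel (A i))" .
  qed simp
  then have "P = lborel_rvec d" by (simp add: lborel_rvec_def)
  then show ?thesis using em[OF B] by simp
qed

text \<open>Induction on the number of coordinates that may be fractional: such a point lies between
  the two points that have 0 and 1 in the last of these coordinates.\<close>

lemma unit_cube_in_convex:
  assumes Z: "convex_rvec d Z" and vert: "{1..d} \<rightarrow>\<^sub>E {0, 1} \<subseteq> Z"
  shows "unit_cube d \<subseteq> Z"
proof -
  have "y \<in> Z" if "n \<le> d" "y \<in> rvec d" "\<And>i. i \<in> {1..n} \<Longrightarrow> y i \<in> {0..1}"
    "\<And>i. i \<in> {n<..d} \<Longrightarrow> y i \<in> {0, 1}" for n y
    using that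
  proof (induction n arbitrary: y)
    case 0
    then have "y \<in> {1..d} \<rightarrow>\<^sub>E {0, 1}" by (auto simp: rvec_def PiE_iff)
    then show ?case using vert by blast
  next
    case (Suc n)
    have upd: "y(Suc n := e) \<in> Z" if "e \<in> {0, 1}" for e
    proof (rule Suc.IH)
      show "y(Suc n := e) \<in> rvec d"
        using Suc.prems(1,2) by (auto simp: rvec_def PiE_iff extensional_def)
      show "(y(Suc n := e)) i \<in> {0..1}" if "i \<in> {1..n}" for i
        using Suc.prems(3)[of i] that by auto
      show "(y(Suc n := e)) i \<in> {0, 1}" if "i \<in> {n<..d}" for i
        using Suc.prems(4)[of i] that \<open>e \<in> {0, 1}\<close> by auto
    qed (use Suc.prems in simp)
    have "y (Suc n) \<in> {0..1}" using Suc.prems(3)[of "Suc n"] by auto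
    then have "mix d (y (Suc n)) (y(Suc n := 0)) (y(Suc n := 1)) \<in> Z"
      using upd by (intro convex_rvec_mixD[OF Z]) auto
    also have "mix d (y (Suc n)) (y(Suc n := 0)) (y(Suc n := 1)) = y"
      using Suc.prems(2) by (intro rvec_eqI[of _ d]) (auto simp: algebra_simps)
    finally show ?case .
  qed
  from this[of d] show ?thesis by (force simp: unit_cube_def rvec_def PiE_iff)
qed

text \<open>These are the facts about the measure on the affine hull that the regret analysis uses:
  \<open>K\<close> has positive finite mass, and a homothety centred in \<open>K\<close> scales mass
  with an exponent of at most \<open>k\<close>, whatever the dimension of the hull.\<close>

lemma affine_lborel_convex:
  assumes cv: "convex_rvec k K" and ne: "K \<noteq> {}" and cube: "K \<subseteq> unit_cube k"
    and meas: "K \<in> sets (lborel_rvec k)"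
  obtains d where "d \<le> k"
    "sets (affine_lborel k (affine_rvec k hull K)) = sets (lborel_rvec k)"
    "emeasure (affine_lborel k (affine_rvec k hull K)) K > 0"
    "emeasure (affine_lborel k (affine_rvec k hull K)) K < \<infinity>"
    "\<And>S S' z m. S \<in> sets (lborel_rvec k) \<Longrightarrow> S' \<in> sets (lborel_rvec k) \<Longrightarrow> S \<subseteq> K \<Longrightarrow> z \<in> K \<Longrightarrow> 0 < m \<Longrightarrow>
        (\<And>x. x \<in> S \<Longrightarrow> mix k m z x \<in> S') \<Longrightarrow>
        ennreal (m ^ d) * emeasure (affine_lborel k (affine_rvec k hull K)) S
          \<le> emeasure (affine_lborel k (affine_rvec k hull K)) S'"
proof -
  let ?A = "affine_rvec k hull K"
  define M where "M = affine_lborel k ?A"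
  have KR: "K \<subseteq> rvec k" using cv by (simp add: convex_rvec_def)
  have KA: "K \<subseteq> ?A" by (rule hull_subset)
  have "\<exists>M d b u. orthonormal_frame k d b u ?A \<and> M = distr (lborel_rvec d) (lborel_rvec k) (frame_map k d b u)"
    using orthonormal_frame_exists[OF affine_rvec_hull[OF KR]] ne KA by blast
  then have "\<exists>d b u. orthonormal_frame k d b u ?A \<and> M = distr (lborel_rvec d) (lborel_rvec k) (frame_map k d b u)"
    unfolding M_def affine_lborel_def by (rule someI_ex)
  then obtain d b u where fr: "orthonormal_frame k d b u ?A"
    and M: "M = distr (lborel_rvec d) (lborel_rvec k) (frame_map k d b u)" by blast
  define F where "F = frame_map k d b u"
  have on: "orthonormal_on k d u" and img: "?A = F ` rvec d"
    using fr by (auto simp: orthonormal_frame_def orthonormal_on_def F_def)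
  define pre where "pre S = {y \<in> rvec d. F y \<in> S}" for S
  have em: "emeasure M S = emeasure (lborel_rvec d) (pre S)" if "S \<in> sets (lborel_rvec k)" for S
  proof -
    have "emeasure M S = emeasure (lborel_rvec d) (F -` S \<inter> rvec d)"
      unfolding M F_def using that by (simp add: emeasure_distr)
    also have "F -` S \<inter> rvec d = pre S" by (auto simp: pre_def)
    finally show ?thesis .
  qed
  have pre_sets: "pre S \<in> sets (lborel_rvec d)" if "S \<in> sets (lborel_rvec k)" for S
  proof -
    have "pre S = F -` S \<inter> space (lborel_rvec d)" by (auto simp: pre_def)
    then show ?thesis unfolding F_def using measurable_sets[OF measurable_frame_map that] by simp
  qed
  have contr: "ennreal (m ^ d) * emeasure M S \<le> emeasure M S'"
    if S: "S \<in> sets (lborel_rvec k)" "S' \<in> sets (lborel_rvec k)" "S \<subseteq> K" and z: "z \<in> K" and m: "0 < m"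
      and sub: "\<And>x. x \<in> S \<Longrightarrow> mix k m z x \<in> S'" for S S' z m
  proof -
    obtain y0 where y0: "y0 \<in> rvec d" "z = F y0" using z KA img by blast
    have "pre S \<subseteq> {y \<in> rvec d. mix d m y0 y \<in> pre S'}"
      using sub by (auto simp: pre_def F_def y0 frame_map_mix)
    moreover have "{y \<in> rvec d. mix d m y0 y \<in> pre S'} \<in> sets (lborel_rvec d)"
    proof -
      have "mix d m y0 -` pre S' \<inter> space (lborel_rvec d) \<in> sets (lborel_rvec d)"
        using pre_sets[OF S(2)] by (rule measurable_sets[OF measurable_mix])
      also have "mix d m y0 -` pre S' \<inter> space (lborel_rvec d) = {y \<in> rvec d. mix d m y0 y \<in> pre S'}"
        by auto
      finally show ?thesis .
    qed
    ultimately have "emeasure M S \<le> emeasure (lborel_rvec d) {y \<in> rvec d. mix d m y0 y \<in> pre S'}"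
      unfolding em[OF S(1)] by (rule emeasure_mono)
    then have "ennreal (m ^ d) * emeasure M S
       \<le> ennreal (m ^ d) * emeasure (lborel_rvec d) {y \<in> rvec d. mix d m y0 y \<in> pre S'}"
      by (rule mult_left_mono) simp
    also have "\<dots> = emeasure M S'"
      unfolding emeasure_mix_vimage[OF m pre_sets[OF S(2)]] em[OF S(2)] ..
    finally show ?thesis .
  qed
  have "emeasure M K < \<infinity>"
  proof -
    \<comment> \<open>A frame coordinate is an inner product of \<open>F y - b\<close> with
      \<open>u j\<close>, and \<open>F y\<close> lies in the cube, so the preimage of
      \<open>K\<close> lies in a box.\<close>
    define r where "r j = (\<Sum>i=1..k. (1 + \<bar>b i\<bar>) * \<bar>u j i\<bar>)" for j
    have "pre K \<subseteq> Pi\<^sub>E {1..d} (\<lambda>j. {- r j..r j})"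
    proof
      fix y assume y: "y \<in> pre K"
      then have FK: "F y \<in> unit_cube k" using cube by (auto simp: pre_def)
      have bd: "\<bar>y j\<bar> \<le> r j" if j: "j \<in> {1..d}" for j
      proof -
        have "y j = (\<Sum>i=1..k. (F y i - b i) * u j i)"
          unfolding F_def by (rule frame_map_coord[OF on j])
        also have "\<bar>\<dots>\<bar> \<le> (\<Sum>i=1..k. \<bar>(F y i - b i) * u j i\<bar>)" by (rule sum_abs)
        also have "\<dots> \<le> r j"
          unfolding r_def
        proof (rule sum_mono)
          fix i assume "i \<in> {1..k}"
          then have "F y i \<in> {0..1}" using FK by (auto simp: unit_cube_def)
          then have "\<bar>F y i - b i\<bar> \<le> 1 + \<bar>b i\<bar>" by auto
          then show "\<bar>(F y i - b i) * u j i\<bar> \<le> (1 + \<bar>b i\<bar>) * \<bar>u j i\<bar>"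
            by (simp add: abs_mult mult_right_mono)
        qed
        finally show ?thesis .
      qed
      have "y \<in> extensional {1..d}" using y by (simp add: pre_def rvec_def PiE_iff)
      moreover have "y j \<in> {- r j..r j}" if "j \<in> {1..d}" for j
        using bd[OF that] by (simp add: abs_le_iff minus_le_iff)
      ultimately show "y \<in> Pi\<^sub>E {1..d} (\<lambda>j. {- r j..r j})"
        unfolding PiE_iff by blast
    qed
    then have "emeasure M K \<le> emeasure (lborel_rvec d) (Pi\<^sub>E {1..d} (\<lambda>j. {- r j..r j}))"
      unfolding em[OF meas]
      by (rule emeasure_mono) (auto simp: lborel_rvec_def intro!: sets_PiM_I_finite)
    also have "\<dots> = (\<Prod>j\<in>{1..d}. emeasure lborel {- r j..r j})"
      by (rule emeasure_lborel_box) simp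
    also have "\<dots> < \<infinity>"
      by (simp add: ennreal_prod_eq_top emeasure_lborel_Icc_eq less_top[symmetric])
    finally show ?thesis .
  qed
  moreover have "emeasure M K > 0"
  proof -
    \<comment> \<open>The images of the finitely many vertices of the \<open>d\<close>-cube share
      one starting point and one ratio. This contraction takes the vertices, and by convexity the
      whole cube, into the preimage of \<open>K\<close>.\<close>
    let ?V = "{1..d} \<rightarrow>\<^sub>E {0, 1::real}"
    have V: "?V \<subseteq> rvec d" by (auto simp: rvec_def PiE_iff)
    have "\<exists>q m. reachable_from k K q m x" if "x \<in> F ` ?V" for x
      by (rule hull_reachable[OF cv]) (use that V img in blast)
    then obtain q m where q: "q \<in> K" "0 < m" "m \<le> 1" "\<forall>x\<in>F ` ?V. reachable_from k K q m x"
      using reachable_from_finite[OF cv ne, of "F ` ?V"] by (auto simp: finite_PiE)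
    obtain y0 where y0: "y0 \<in> rvec d" "q = F y0" using q KA img by blast
    have "convex_rvec d {y \<in> rvec d. mix d m y0 y \<in> pre K}"
      unfolding convex_rvec_def
    proof (intro conjI ballI)
      fix x y s assume x: "x \<in> {y \<in> rvec d. mix d m y0 y \<in> pre K}"
        and y: "y \<in> {y \<in> rvec d. mix d m y0 y \<in> pre K}" and s: "s \<in> {0..1::real}"
      have e: "mix d m y0 (mix d s x y) = mix d s (mix d m y0 x) (mix d m y0 y)"
        by (intro rvec_eqI[of _ d]) (auto simp: algebra_simps)
      have "mix k s (F (mix d m y0 x)) (F (mix d m y0 y)) \<in> K"
        using x y s by (intro convex_rvec_mixD[OF cv]) (auto simp: pre_def)
      then have "F (mix d m y0 (mix d s x y)) \<in> K"
        by (simp add: e F_def frame_map_mix)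
      then show "mix d s x y \<in> {y \<in> rvec d. mix d m y0 y \<in> pre K}" by (simp add: pre_def)
    qed auto
    moreover have "?V \<subseteq> {y \<in> rvec d. mix d m y0 y \<in> pre K}"
      using V q(4) by (auto simp: pre_def reachable_from_def F_def frame_map_mix y0)
    ultimately have "unit_cube d \<subseteq> {y \<in> rvec d. mix d m y0 y \<in> pre K}"
      by (rule unit_cube_in_convex)
    moreover have "{y \<in> rvec d. mix d m y0 y \<in> pre K} \<in> sets (lborel_rvec d)"
    proof -
      have "mix d m y0 -` pre K \<inter> space (lborel_rvec d) \<in> sets (lborel_rvec d)"
        using pre_sets[OF meas] by (rule measurable_sets[OF measurable_mix])
      also have "mix d m y0 -` pre K \<inter> space (lborel_rvec d) = {y \<in> rvec d. mix d m y0 y \<in> pre K}"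
        by auto
      finally show ?thesis .
    qed
    ultimately have "emeasure (lborel_rvec d) (unit_cube d)
        \<le> emeasure (lborel_rvec d) {y \<in> rvec d. mix d m y0 y \<in> pre K}" by (rule emeasure_mono)
    moreover have "emeasure (lborel_rvec d) (unit_cube d) = 1"
      unfolding unit_cube_def by (subst emeasure_lborel_box) auto
    ultimately have "ennreal (m ^ d) * 1 \<le> ennreal (m ^ d) * emeasure (lborel_rvec d) {y \<in> rvec d. mix d m y0 y \<in> pre K}"
      by (intro mult_left_mono) auto
    also have "\<dots> = emeasure M K"
      unfolding emeasure_mix_vimage[OF q(2) pre_sets[OF meas]] em[OF meas] ..
    finally show ?thesis using q(2) by (simp add: order.strict_trans2[of 0 "ennreal (m ^ d)"])
  qed
  ultimately show ?thesis
    using that[of d, folded M_def] orthonormal_on_le[OF on] contr by (simp add: M)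
qed

subsection \<open>Charging points of shrinking sets\<close>

text \<open>The pointwise bound on the charge, integrated over \<open>E\<close>.\<close>

lemma sum_measure_Int_le:
  assumes fin: "finite I" and E: "E \<in> sets M" "emeasure M E < \<infinity>"
    and H: "\<And>s. s \<in> I \<Longrightarrow> H s \<in> sets M"
    and bd: "\<And>x. x \<in> E \<Longrightarrow> (\<Sum>s\<in>I. w s * indicator (H s) x) \<le> (G::real)"
  shows "(\<Sum>s\<in>I. w s * measure M (H s \<inter> E)) \<le> G * measure M E"
proof -
  have finHE: "emeasure M (H s \<inter> E) < \<infinity>" if "s \<in> I" for s
    using E emeasure_mono[of "H s \<inter> E" E M] by (auto intro: le_less_trans)
  have i: "integrable M (\<lambda>x. indicator (H s \<inter> E) x :: real)" if "s \<in> I" for s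
    using H[OF that] E finHE[OF that] by (intro integrable_real_indicator) auto
  have iE: "integrable M (\<lambda>x. indicator E x :: real)"
    using E by (intro integrable_real_indicator) auto
  have "(\<Sum>s\<in>I. w s * measure M (H s \<inter> E)) = (\<Sum>s\<in>I. \<integral>x. w s * indicator (H s \<inter> E) x \<partial>M)"
    using H E by (intro sum.cong) (auto simp: sets.sets_into_space Int_absorb2)
  also have "\<dots> = (\<integral>x. (\<Sum>s\<in>I. w s * indicator (H s \<inter> E) x) \<partial>M)"
    using i by (intro Bochner_Integration.integral_sum[symmetric]) auto
  also have "\<dots> \<le> (\<integral>x. G * indicator E x \<partial>M)"
  proof (rule integral_mono)
    show "integrable M (\<lambda>x. \<Sum>s\<in>I. w s * indicator (H s \<inter> E) x)"
      using i by (intro Bochner_Integration.integrable_sum) auto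
    show "integrable M (\<lambda>x. G * indicator E x)" using iE by auto
    show "(\<Sum>s\<in>I. w s * indicator (H s \<inter> E) x) \<le> G * indicator E x" for x
      using bd[of x] by (cases "x \<in> E") (auto simp: indicator_inter_arith)
  qed
  also have "\<dots> = G * measure M E"
    using E by (simp add: sets.sets_into_space Int_absorb2)
  finally show ?thesis .
qed

text \<open>
  \<open>w t\<close> is charged to the points of \<open>H t\<close>, and no point is charged more than \<open>G\<close> while it
  survives. A point removed at time \<open>t\<close> contributes at most \<open>G / measure M (K t)\<close>, and these
  contributions telescope into a logarithm.
\<close>

lemma charge_le_log_measure:
  fixes w :: "nat \<Rightarrow> real"
  assumes "n \<le> m"
    and K: "\<And>t. t \<in> {n..m} \<Longrightarrow> K t \<in> sets M" "\<And>t. t \<in> {n..m} \<Longrightarrow> emeasure M (K t) < \<infinity>"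
      "\<And>t. t \<in> {n..m} \<Longrightarrow> measure M (K t) > 0" "\<And>t. t \<in> {n..<m} \<Longrightarrow> K (Suc t) \<subseteq> K t"
    and H: "\<And>t. t \<in> {n..m} \<Longrightarrow> H t \<in> sets M" "\<And>t. t \<in> {n..m} \<Longrightarrow> H t \<subseteq> K t"
    and w: "\<And>t. t \<in> {n..m} \<Longrightarrow> 0 \<le> w t" and G: "0 \<le> G"
    and bd: "\<And>t x. t \<in> {n..m} \<Longrightarrow> x \<in> K t \<Longrightarrow> (\<Sum>s=n..t. w s * indicator (H s) x) \<le> G"
  shows "(\<Sum>t=n..m. w t * measure M (H t) / measure M (K t))
       \<le> G * (1 + ln (measure M (K n) / measure M (K m)))"
proof -
  let ?V = "\<lambda>t. measure M (K t)"
  \<comment> \<open>The mean, over the points still present at time \<open>t\<close>, of the charge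
    collected up to time \<open>t\<close>.\<close>
  define avg where "avg t = (\<Sum>s=n..t. w s * measure M (H s \<inter> K t)) / ?V t" for t
  have main: "(\<Sum>s=n..t. w s * measure M (H s) / ?V s) \<le> avg t + G * ln (?V n / ?V t)"
    if "n \<le> t" "t \<le> m" for t
    using that
  proof (induction t rule: dec_induct)
    case base
    then show ?case using H(2)[of n] K(3)[of n] by (simp add: avg_def Int_absorb2)
  next
    case (step t)
    have t: "t \<in> {n..m}" "Suc t \<in> {n..m}" "t \<in> {n..<m}" using step by auto
    have pos: "?V t > 0" "?V (Suc t) > 0" "?V n > 0" using K(3) t \<open>n \<le> m\<close> by auto
    \<comment> \<open>The same charges averaged over the survivors of step \<open>t\<close> only,
      before the charge of time \<open>Suc t\<close> is added.\<close>
    define a' where "a' = (\<Sum>s=n..t. w s * measure M (H s \<inter> K (Suc t))) / ?V (Suc t)"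
    define \<rho> where "\<rho> = ?V (Suc t) / ?V t"
    have sub: "K (Suc t) \<subseteq> K t" using K(4) t by simp
    have fmt: "K t \<in> fmeasurable M" "K (Suc t) \<in> fmeasurable M"
      using K(1,2) t by (auto intro!: fmeasurableI)
    have "?V (Suc t) \<le> ?V t" using sub fmt by (intro measure_mono_fmeasurable) auto
    then have \<rho>: "0 < \<rho>" "\<rho> \<le> 1" using pos by (auto simp: \<rho>_def)
    have a'0: "a' \<ge> 0" unfolding a'_def using w t(1) by (auto intro!: divide_nonneg_nonneg sum_nonneg)
    have Hm: "measure M (H s \<inter> K t) = measure M (H s \<inter> K (Suc t)) + measure M (H s \<inter> (K t - K (Suc t)))"
      if "s \<in> {n..t}" for s
    proof -
      have Hs: "H s \<in> sets M" using H(1) that t by auto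
      have "H s \<inter> K t = (H s \<inter> K (Suc t)) \<union> (H s \<inter> (K t - K (Suc t)))" using sub by auto
      moreover have "measure M ((H s \<inter> K (Suc t)) \<union> (H s \<inter> (K t - K (Suc t))))
         = measure M (H s \<inter> K (Suc t)) + measure M (H s \<inter> (K t - K (Suc t)))"
      proof (rule measure_Union)
        have "H s \<inter> K (Suc t) \<in> fmeasurable M" "H s \<inter> (K t - K (Suc t)) \<in> fmeasurable M"
          using fmeasurable_Int_fmeasurable[OF fmt(2) Hs]
            fmeasurable_Int_fmeasurable[OF fmeasurable.Diff[OF fmt] Hs] by (simp_all add: Int_commute)
        then show "emeasure M (H s \<inter> K (Suc t)) \<noteq> \<infinity>" "emeasure M (H s \<inter> (K t - K (Suc t))) \<noteq> \<infinity>"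
          "H s \<inter> K (Suc t) \<in> sets M" "H s \<inter> (K t - K (Suc t)) \<in> sets M"
          by (auto simp: fmeasurable_def)
      qed auto
      ultimately show ?thesis by simp
    qed
    \<comment> \<open>The points removed at this step still lie in \<open>K t\<close>, so each of
      them carries at most \<open>G\<close>.\<close>
    have "(\<Sum>s=n..t. w s * measure M (H s \<inter> (K t - K (Suc t)))) \<le> G * measure M (K t - K (Suc t))"
    proof (rule sum_measure_Int_le)
      show "emeasure M (K t - K (Suc t)) < \<infinity>"
        using K(2)[OF t(1)] K(1)[OF t(1)] emeasure_mono[of "K t - K (Suc t)" "K t" M]
        by (auto intro: le_less_trans)
    qed (use t K(1) H(1) bd in auto)
    also have "measure M (K t - K (Suc t)) = ?V t - ?V (Suc t)"
      using fmt sub by (intro measure_Diff) (auto simp: fmeasurable_def)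
    finally have R: "(\<Sum>s=n..t. w s * measure M (H s \<inter> K t)) \<le> a' * ?V (Suc t) + G * (?V t - ?V (Suc t))"
      using pos by (simp add: Hm a'_def distrib_left sum.distrib)
    have "avg t \<le> (a' * ?V (Suc t) + G * (?V t - ?V (Suc t))) / ?V t"
      unfolding avg_def using R pos by (intro divide_right_mono) auto
    also have "\<dots> = a' * \<rho> + G * (1 - \<rho>)"
      using pos by (simp add: \<rho>_def field_simps)
    \<comment> \<open>\<open>\<rho>\<close> is the surviving fraction. The loss is absorbed by
      \<open>1 - \<rho> \<le> ln (1 / \<rho>)\<close>, and these logarithms telescope.\<close>
    also have "\<dots> \<le> a' + G * ln (1 / \<rho>)"
      using a'0 \<rho> G ln_le_minus_one[of \<rho>] by (intro add_mono mult_left_mono) (auto simp: ln_div mult_left_le)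
    finally have 1: "avg t \<le> a' + G * ln (1 / \<rho>)" .
    have "H (Suc t) \<inter> K (Suc t) = H (Suc t)" using H(2)[OF t(2)] by auto
    then have 2: "avg (Suc t) = a' + w (Suc t) * measure M (H (Suc t)) / ?V (Suc t)"
      using t by (simp add: avg_def a'_def add_divide_distrib)
    have 3: "ln (?V n / ?V (Suc t)) = ln (?V n / ?V t) + ln (1 / \<rho>)"
      using pos by (simp add: \<rho>_def ln_div)
    have IH: "(\<Sum>s=n..t. w s * measure M (H s) / ?V s) \<le> avg t + G * ln (?V n / ?V t)"
      using step by auto
    have "(\<Sum>s=n..Suc t. w s * measure M (H s) / ?V s)
        = (\<Sum>s=n..t. w s * measure M (H s) / ?V s) + w (Suc t) * measure M (H (Suc t)) / ?V (Suc t)"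
      using t by simp
    also have "\<dots> \<le> avg (Suc t) + G * ln (?V n / ?V (Suc t))"
      using IH 1 unfolding 2 3 by (simp add: distrib_left)
    finally show ?case .
  qed
  have "(\<Sum>s=n..m. w s * measure M (H s \<inter> K m)) \<le> G * ?V m"
    using \<open>n \<le> m\<close> K(1,2) H(1) bd by (intro sum_measure_Int_le) auto
  then have "avg m \<le> G"
    using K(3)[of m] \<open>n \<le> m\<close> by (simp add: avg_def divide_le_eq)
  then show ?thesis using main[of m] \<open>n \<le> m\<close> by (simp add: distrib_left)
qed

subsection \<open>The consistent sets\<close>

text \<open>The regret bound of the agent enters later as the premise that \<open>v\<close> belongs
  to every \<open>K t\<close>.\<close>

locale prediction_game =
  fixes k :: nat and f :: "nat \<Rightarrow> real" and c :: "nat \<Rightarrow> nat \<Rightarrow> real" and a p :: "nat \<Rightarrow> nat"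
    and v :: "nat \<Rightarrow> real"
  assumes mono: "mono_on {1..} f"
    and v_cube: "v \<in> unit_cube k"
    and a_arm: "\<And>t. 1 \<le> t \<Longrightarrow> a t \<in> {1..k}"
    and algorithm: "prediction_algorithm k f c a p"
begin

text \<open>The agent's regret at time \<open>t\<close> if the values were \<open>w\<close>; it is the least \<open>r t\<close> admissible in \<^const>\<open>CV\<close>.\<close>

definition pen :: "nat \<Rightarrow> (nat \<Rightarrow> real) \<Rightarrow> real" where
  "pen t w = Max ((\<lambda>i. w i - c t i) ` {1..k}) - (w (a t) - c t (a t))"

definition cum :: "nat \<Rightarrow> (nat \<Rightarrow> real) \<Rightarrow> real" where
  "cum l w = (\<Sum>s=1..l. pen s w)"

abbreviation K :: "nat \<Rightarrow> (nat \<Rightarrow> real) set" where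
  "K \<equiv> CV k f c a"

text \<open>Affine in \<open>w\<close> and zero at \<open>v\<close>, so a contraction towards
  \<open>v\<close> multiplies it by the ratio. Under \<open>w\<close>, arm \<open>p t\<close> beats
  \<open>a t\<close> at time \<open>t\<close> by exactly
  \<open>dev (p t) (a t) w - gap t\<close>.\<close>

definition dev :: "nat \<Rightarrow> nat \<Rightarrow> (nat \<Rightarrow> real) \<Rightarrow> real" where
  "dev i j w = (w i - w j) - (v i - v j)"

definition gap :: "nat \<Rightarrow> real" where
  "gap t = (v (a t) - c t (a t)) - (v (p t) - c t (p t))"

abbreviation M :: "nat \<Rightarrow> (nat \<Rightarrow> real) measure" where
  "M t \<equiv> affine_lborel k (affine_rvec k hull (K t))"

section \<open>The agent's regret as a convex function of the values, Lipschitz on the cube\<close>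

lemma k_pos: "1 \<le> k"
  using a_arm[of 1] by auto

lemma p_arm: "1 \<le> t \<Longrightarrow> p t \<in> {1..k}"
  using algorithm by (auto simp: prediction_algorithm_def is_arg_max_def)

lemma f_mono: "1 \<le> s \<Longrightarrow> s \<le> t \<Longrightarrow> f s \<le> f t"
  using mono by (auto simp: mono_on_def)

lemma pen_le_iff: "pen t w \<le> r \<longleftrightarrow> (\<forall>i\<in>{1..k}. (w i - c t i) - (w (a t) - c t (a t)) \<le> r)"
proof -
  have "pen t w \<le> r \<longleftrightarrow> Max ((\<lambda>i. w i - c t i) ` {1..k}) \<le> r + (w (a t) - c t (a t))"
    by (auto simp: pen_def)
  also have "\<dots> \<longleftrightarrow> (\<forall>x\<in>(\<lambda>i. w i - c t i) ` {1..k}. x \<le> r + (w (a t) - c t (a t)))"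
    using k_pos by (intro Max_le_iff) auto
  also have "\<dots> \<longleftrightarrow> (\<forall>i\<in>{1..k}. (w i - c t i) - (w (a t) - c t (a t)) \<le> r)"
    by (auto simp: algebra_simps)
  finally show ?thesis .
qed

lemma pen_ge: "i \<in> {1..k} \<Longrightarrow> (w i - c t i) - (w (a t) - c t (a t)) \<le> pen t w"
  using pen_le_iff[of t w "pen t w"] by auto

lemma pen_nonneg: "1 \<le> t \<Longrightarrow> 0 \<le> pen t w"
  using pen_ge[of "a t" w t] a_arm[of t] by simp

lemma pen_mix:
  assumes "0 \<le> m" "m \<le> 1" "1 \<le> t"
  shows "pen t (mix k m x y) \<le> (1 - m) * pen t x + m * pen t y"
  unfolding pen_le_iff
proof
  fix i assume i: "i \<in> {1..k}"
  have "(mix k m x y i - c t i) - (mix k m x y (a t) - c t (a t))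
      = (1 - m) * ((x i - c t i) - (x (a t) - c t (a t))) + m * ((y i - c t i) - (y (a t) - c t (a t)))"
    unfolding mix_apply[OF i] mix_apply[OF a_arm[OF assms(3)]] by (simp add: algebra_simps)
  also have "\<dots> \<le> (1 - m) * pen t x + m * pen t y"
    using assms by (intro add_mono mult_left_mono pen_ge i) auto
  finally show "(mix k m x y i - c t i) - (mix k m x y (a t) - c t (a t)) \<le> \<dots>" .
qed

lemma cum_mix:
  assumes "0 \<le> m" "m \<le> 1"
  shows "cum l (mix k m x y) \<le> (1 - m) * cum l x + m * cum l y"
  unfolding cum_def sum_distrib_left sum.distrib[symmetric]
  using assms by (intro sum_mono pen_mix) auto

lemma unit_cube_bounds: "x \<in> unit_cube k \<Longrightarrow> i \<in> {1..k} \<Longrightarrow> 0 \<le> x i \<and> x i \<le> 1"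
  by (auto simp: unit_cube_def PiE_iff)

text \<open>The costs cancel, however large they are, and on the cube a difference of two values
  varies by at most 2.\<close>

lemma pen_lipschitz:
  assumes "x \<in> unit_cube k" "y \<in> unit_cube k" "1 \<le> t"
  shows "pen t y \<le> pen t x + 2"
  unfolding pen_le_iff
proof
  fix i assume i: "i \<in> {1..k}"
  show "(y i - c t i) - (y (a t) - c t (a t)) \<le> pen t x + 2"
    using pen_ge[OF i, of x t] unit_cube_bounds[OF assms(1) i] unit_cube_bounds[OF assms(2) i]
      unit_cube_bounds[OF assms(1) a_arm[OF assms(3)]] unit_cube_bounds[OF assms(2) a_arm[OF assms(3)]]
    by linarith
qed

lemma cum_lipschitz:
  assumes "x \<in> unit_cube k" "y \<in> unit_cube k"
  shows "cum l y \<le> cum l x + 2 * real l"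
proof -
  have "cum l y \<le> (\<Sum>s=1..l. pen s x + 2)"
    unfolding cum_def using assms by (intro sum_mono pen_lipschitz) auto
  then show ?thesis by (simp add: cum_def sum.distrib)
qed

lemma cum_mono: "l \<le> l' \<Longrightarrow> cum l w \<le> cum l' w"
  unfolding cum_def by (intro sum_mono2) (auto intro: pen_nonneg)

lemma cum_Suc: "cum (Suc l) w = cum l w + pen (Suc l) w"
  by (simp add: cum_def)

text \<open>Since \<open>pen l w\<close> is the least admissible \<open>r l\<close> and the
  constraints bound partial sums from above, the existential over \<open>r\<close> can be resolved
  by this choice.\<close>

lemma K_iff: "w \<in> K t \<longleftrightarrow> w \<in> unit_cube k \<and> (\<forall>l\<in>{1..<t}. cum l w \<le> f l)"
proof -
  have "(\<exists>r :: nat \<Rightarrow> real.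
       (\<forall>l\<in>{1..<t}. \<forall>i\<in>{1..k}. w (a l) - c l (a l) \<ge> w i - c l i - r l) \<and>
       (\<forall>l\<in>{1..<t}. (\<Sum>j=1..l. r j) \<le> f l)) \<longleftrightarrow> (\<forall>l\<in>{1..<t}. cum l w \<le> f l)"
  proof
    assume "\<exists>r :: nat \<Rightarrow> real.
       (\<forall>l\<in>{1..<t}. \<forall>i\<in>{1..k}. w (a l) - c l (a l) \<ge> w i - c l i - r l) \<and>
       (\<forall>l\<in>{1..<t}. (\<Sum>j=1..l. r j) \<le> f l)"
    then obtain r :: "nat \<Rightarrow> real" where
      r: "\<And>l i. l \<in> {1..<t} \<Longrightarrow> i \<in> {1..k} \<Longrightarrow> w (a l) - c l (a l) \<ge> w i - c l i - r l"
      and rf: "\<And>l. l \<in> {1..<t} \<Longrightarrow> (\<Sum>j=1..l. r j) \<le> f l" by blast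
    have "pen l w \<le> r l" if "l \<in> {1..<t}" for l
      unfolding pen_le_iff using r[OF that] by (auto simp: algebra_simps)
    then have "cum l w \<le> (\<Sum>j=1..l. r j)" if "l \<in> {1..<t}" for l
      unfolding cum_def using that by (intro sum_mono) auto
    then show "\<forall>l\<in>{1..<t}. cum l w \<le> f l" using rf by force
  next
    assume "\<forall>l\<in>{1..<t}. cum l w \<le> f l"
    moreover have "w (a l) - c l (a l) \<ge> w i - c l i - pen l w" if "i \<in> {1..k}" for l i
      using pen_ge[OF that, of w l] by linarith
    ultimately show "\<exists>r :: nat \<Rightarrow> real.
       (\<forall>l\<in>{1..<t}. \<forall>i\<in>{1..k}. w (a l) - c l (a l) \<ge> w i - c l i - r l) \<and>
       (\<forall>l\<in>{1..<t}. (\<Sum>j=1..l. r j) \<le> f l)"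
      unfolding cum_def by (intro exI[of _ "\<lambda>l. pen l w"]) blast
  qed
  then show ?thesis unfolding CV_def by simp
qed

section \<open>Monotonicity, convexity and measurability of the consistent sets\<close>

lemma K_cube: "K t \<subseteq> unit_cube k"
  using K_iff by blast

lemma cube_rvec: "unit_cube k \<subseteq> rvec k"
  by (auto simp: unit_cube_def rvec_def PiE_iff)

lemma K_antimono: "s \<le> t \<Longrightarrow> K t \<subseteq> K s"
  using K_iff by auto

lemma mix_cube:
  assumes "x \<in> unit_cube k" "y \<in> unit_cube k" "0 \<le> m" "m \<le> 1"
  shows "mix k m x y \<in> unit_cube k"
proof -
  have "mix k m x y i \<in> {0..1}" if "i \<in> {1..k}" for i
  proof -
    have "(1 - m) * x i + m * y i \<le> (1 - m) * 1 + m * 1"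
      using assms unit_cube_bounds[OF _ that] by (intro add_mono mult_left_mono) auto
    then show ?thesis
      unfolding mix_apply[OF that] using assms unit_cube_bounds[OF _ that] by auto
  qed
  then show ?thesis by (auto simp: unit_cube_def PiE_iff mix_def)
qed

lemma K_convex: "convex_rvec k (K t)"
  unfolding convex_rvec_def
proof (intro conjI ballI)
  show "K t \<subseteq> rvec k" using K_cube cube_rvec by blast
  fix x y and m :: real assume x: "x \<in> K t" and y: "y \<in> K t" and m: "m \<in> {0..1}"
  have "cum l (mix k m x y) \<le> f l" if l: "l \<in> {1..<t}" for l
  proof -
    have "cum l (mix k m x y) \<le> (1 - m) * cum l x + m * cum l y"
      using m by (intro cum_mix) auto
    also have "\<dots> \<le> (1 - m) * f l + m * f l"
      using x y m l by (intro add_mono mult_left_mono) (auto simp: K_iff)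
    finally show ?thesis by (simp add: algebra_simps)
  qed
  then show "mix k m x y \<in> K t"
    using x y m by (auto simp: K_iff intro: mix_cube)
qed

lemma measurable_pen [measurable]: "1 \<le> t \<Longrightarrow> pen t \<in> borel_measurable (lborel_rvec k)"
proof -
  assume t: "1 \<le> t"
  have [measurable]: "(\<lambda>w. w (a t)) \<in> borel_measurable (lborel_rvec k)"
    using a_arm[OF t] by (rule measurable_rvec_component)
  have [measurable]: "(\<lambda>w. Max ((\<lambda>i. w i - c t i) ` {1..k})) \<in> borel_measurable (lborel_rvec k)"
    by (rule borel_measurable_Max) (auto intro!: borel_measurable_diff)
  have "(\<lambda>w. Max ((\<lambda>i. w i - c t i) ` {1..k}) - (w (a t) - c t (a t))) \<in> borel_measurable (lborel_rvec k)"
    by measurable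
  then show ?thesis by (simp add: pen_def[abs_def])
qed

lemma measurable_cum [measurable]: "cum l \<in> borel_measurable (lborel_rvec k)"
  unfolding cum_def[abs_def] by (intro borel_measurable_sum measurable_pen) auto

lemma cube_sets: "unit_cube k \<in> sets (lborel_rvec k)"
  unfolding unit_cube_def lborel_rvec_def by (intro sets_PiM_I_finite) auto

lemma K_sets: "K t \<in> sets (lborel_rvec k)"
proof -
  have "K t = unit_cube k \<inter> {w \<in> space (lborel_rvec k). \<forall>l\<in>{1..<t}. cum l w \<le> f l}"
    using cube_rvec by (auto simp: K_iff)
  also have "\<dots> \<in> sets (lborel_rvec k)"
    using cube_sets by (intro sets.Int sets.sets_Collect_finite_All borel_measurable_le) auto
  finally show ?thesis .
qed

lemma measurable_dev [measurable]:
  "i \<in> {1..k} \<Longrightarrow> j \<in> {1..k} \<Longrightarrow> dev i j \<in> borel_measurable (lborel_rvec k)"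
  unfolding dev_def[abs_def] by (intro borel_measurable_diff measurable_rvec_component) auto

lemma dev_v [simp]: "dev i j v = 0"
  by (simp add: dev_def)

lemma dev_mix:
  "i \<in> {1..k} \<Longrightarrow> j \<in> {1..k} \<Longrightarrow> dev i j (mix k m x y) = (1 - m) * dev i j x + m * dev i j y"
  by (simp add: dev_def algebra_simps)

end

subsection \<open>Mass and extent of the points that are hit\<close>

lemma measure_uniform_dist:
  assumes "emeasure (affine_lborel k (affine_rvec k hull S)) S > 0"
    "emeasure (affine_lborel k (affine_rvec k hull S)) S < \<infinity>"
    "B \<in> sets (affine_lborel k (affine_rvec k hull S))"
  shows "measure (uniform_dist k S) B
    = measure (affine_lborel k (affine_rvec k hull S)) (S \<inter> B) / measure (affine_lborel k (affine_rvec k hull S)) S"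
  unfolding uniform_dist_def using assms by (intro measure_uniform_measure) auto

context prediction_game
begin

text \<open>Chosen so that a contraction of ratio \<open>1 - hit_slack\<close> loses at most the
  fraction \<open>k * hit_slack = 1 / (2 * k)\<close> of the mass, half of the share guaranteed to
  the predicted arm.\<close>

definition hit_slack :: real where
  "hit_slack = 1 / (2 * (real k)\<^sup>2)"

text \<open>Division by \<open>1 - hit_slack\<close> makes the contraction towards \<open>v\<close>
  carry the complement of \<open>hit t\<close> to points where \<open>dev\<close> is below
  \<open>gap t\<close>.\<close>

definition hit :: "nat \<Rightarrow> (nat \<Rightarrow> real) set" where
  "hit t = {w \<in> K t. gap t / (1 - hit_slack) \<le> dev (p t) (a t) w}"

lemma hit_slack_bounds: "0 < hit_slack" "hit_slack \<le> 1/2" "real k * hit_slack = 1 / (2 * real k)"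
proof -
  have "1 \<le> (real k)\<^sup>2" using k_pos by (simp add: one_le_power)
  then show "0 < hit_slack" "hit_slack \<le> 1/2" using k_pos by (auto simp: hit_slack_def divide_le_eq_1)
  show "real k * hit_slack = 1 / (2 * real k)" using k_pos by (simp add: hit_slack_def power2_eq_square)
qed

lemma sets_dev:
  assumes "1 \<le> t"
  shows "{w \<in> K t. x \<le> dev (p t) (a t) w} \<in> sets (lborel_rvec k)"
    and "{w \<in> K t. dev (p t) (a t) w < x} \<in> sets (lborel_rvec k)"
proof -
  have [measurable]: "dev (p t) (a t) \<in> borel_measurable (lborel_rvec k)"
    using assms by (intro measurable_dev p_arm a_arm)
  have sets: "{w \<in> space (lborel_rvec k). x \<le> dev (p t) (a t) w} \<in> sets (lborel_rvec k)"
    "{w \<in> space (lborel_rvec k). dev (p t) (a t) w < x} \<in> sets (lborel_rvec k)"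
    by measurable
  have "{w \<in> K t. x \<le> dev (p t) (a t) w} = K t \<inter> {w \<in> space (lborel_rvec k). x \<le> dev (p t) (a t) w}"
    "{w \<in> K t. dev (p t) (a t) w < x} = K t \<inter> {w \<in> space (lborel_rvec k). dev (p t) (a t) w < x}"
    using K_cube cube_rvec by auto
  then show "{w \<in> K t. x \<le> dev (p t) (a t) w} \<in> sets (lborel_rvec k)"
    "{w \<in> K t. dev (p t) (a t) w < x} \<in> sets (lborel_rvec k)"
    using sets.Int[OF K_sets sets(1)] sets.Int[OF K_sets sets(2)] by simp_all
qed

lemma hit_sets: "1 \<le> t \<Longrightarrow> hit t \<in> sets (lborel_rvec k)"
  unfolding hit_def by (rule sets_dev)

text \<open>The regret is at least \<open>dev - gap t\<close>, and
  \<open>1 / (1 - s) \<ge> 1 + s\<close> for \<open>s = hit_slack\<close>.\<close>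

lemma pen_hit:
  assumes t: "1 \<le> t" and g: "0 < gap t" and w: "w \<in> hit t"
  shows "gap t * hit_slack \<le> pen t w"
proof -
  have "gap t * (1 + hit_slack) * (1 - hit_slack) \<le> gap t"
    using g hit_slack_bounds(1) by (simp add: algebra_simps)
  then have "gap t * (1 + hit_slack) \<le> gap t / (1 - hit_slack)"
    using hit_slack_bounds by (simp add: pos_le_divide_eq)
  then have "gap t + gap t * hit_slack \<le> dev (p t) (a t) w"
    using w by (simp add: hit_def distrib_left)
  then show ?thesis
    using pen_ge[OF p_arm[OF t], of w t] by (simp add: dev_def gap_def)
qed

section \<open>Masses of parts of \<open>K t\<close> at one fixed time\<close>

context
  fixes t :: nat
  assumes t: "1 \<le> t" and v_in: "v \<in> K t"
begin

lemma M_props: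
  obtains d where "d \<le> k" "sets (M t) = sets (lborel_rvec k)"
    "0 < emeasure (M t) (K t)" "emeasure (M t) (K t) < \<infinity>"
    "\<And>S S' z m. S \<in> sets (lborel_rvec k) \<Longrightarrow> S' \<in> sets (lborel_rvec k) \<Longrightarrow> S \<subseteq> K t \<Longrightarrow> S' \<subseteq> K t \<Longrightarrow>
        z \<in> K t \<Longrightarrow> 0 < m \<Longrightarrow> (\<And>x. x \<in> S \<Longrightarrow> mix k m z x \<in> S') \<Longrightarrow>
        m ^ d * measure (M t) S \<le> measure (M t) S'"
proof (rule affine_lborel_convex[OF K_convex[of t] _ K_cube K_sets])
  show "K t \<noteq> {}" using v_in by auto
  fix d assume d: "d \<le> k" "sets (M t) = sets (lborel_rvec k)"
    and fin: "0 < emeasure (M t) (K t)" "emeasure (M t) (K t) < \<infinity>"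
    and contr: "\<And>S S' z m. S \<in> sets (lborel_rvec k) \<Longrightarrow> S' \<in> sets (lborel_rvec k) \<Longrightarrow> S \<subseteq> K t \<Longrightarrow> z \<in> K t \<Longrightarrow> 0 < m \<Longrightarrow>
        (\<And>x. x \<in> S \<Longrightarrow> mix k m z x \<in> S') \<Longrightarrow> ennreal (m ^ d) * emeasure (M t) S \<le> emeasure (M t) S'"
  have "m ^ d * measure (M t) S \<le> measure (M t) S'"
    if S: "S \<in> sets (lborel_rvec k)" "S' \<in> sets (lborel_rvec k)" "S \<subseteq> K t" "S' \<subseteq> K t" "z \<in> K t" "0 < m"
      "\<And>x. x \<in> S \<Longrightarrow> mix k m z x \<in> S'" for S S' z m
  proof -
    have fm: "S'' \<in> fmeasurable (M t)" if "S'' \<subseteq> K t" "S'' \<in> sets (lborel_rvec k)" for S''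
      using that fin d(2) K_sets emeasure_mono[OF that(1), of "M t"]
      by (auto intro!: fmeasurableI intro: le_less_trans)
    have "ennreal (m ^ d) * emeasure (M t) S \<le> emeasure (M t) S'"
      using contr[OF S(1-3) S(5-7)] .
    then have "ennreal (m ^ d * measure (M t) S) \<le> ennreal (measure (M t) S')"
      using fm S by (simp add: emeasure_eq_measure2 ennreal_mult)
    then show ?thesis by (simp add: ennreal_le_iff)
  qed
  then show thesis using that d fin by blast
qed

lemma M_basic:
  "sets (M t) = sets (lborel_rvec k)" "0 < emeasure (M t) (K t)" "emeasure (M t) (K t) < \<infinity>"
  by (rule M_props, assumption)+

lemma M_fmeasurable: "S \<subseteq> K t \<Longrightarrow> S \<in> sets (lborel_rvec k) \<Longrightarrow> S \<in> fmeasurable (M t)"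
  using M_basic K_sets emeasure_mono[of S "K t" "M t"]
  by (auto intro!: fmeasurableI intro: le_less_trans)

lemma M_pos: "0 < measure (M t) (K t)"
  using M_basic(2,3) by (simp add: measure_def enn2real_positive_iff)

text \<open>Pigeonhole: the regions where a given arm is optimal cover \<open>K t\<close>, and
  \<open>p t\<close> has the heaviest one. In that region \<open>p t\<close> is at least as good as
  \<open>a t\<close>, which means \<open>dev \<ge> gap t\<close>.\<close>

lemma prediction_mass:
  "measure (M t) (K t) / real k \<le> measure (M t) {w \<in> K t. gap t \<le> dev (p t) (a t) w}"
proof -
  define B where "B i = {w \<in> rvec k. \<forall>j\<in>{1..k}. w i - c t i \<ge> w j - c t j}" for i
  have B: "B i \<in> sets (lborel_rvec k)" if "i \<in> {1..k}" for i
  proof -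
    have "{w \<in> space (lborel_rvec k). \<forall>j\<in>{1..k}. w j - c t j \<le> w i - c t i} \<in> sets (lborel_rvec k)"
      using that
      by (intro sets.sets_Collect_finite_All borel_measurable_le borel_measurable_diff
          measurable_rvec_component borel_measurable_const) auto
    then show ?thesis by (simp add: B_def)
  qed
  have wt: "weight k f c a t i = measure (M t) (K t \<inter> B i) / measure (M t) (K t)" if "i \<in> {1..k}" for i
    unfolding weight_def B_def[symmetric]
    using B[OF that] M_basic by (intro measure_uniform_dist) auto
  have le: "measure (M t) (K t \<inter> B i) \<le> measure (M t) (K t \<inter> B (p t))" if i: "i \<in> {1..k}" for i
  proof -
    have "is_arg_max (weight k f c a t) (\<lambda>i. i \<in> {1..k}) (p t)"
      using algorithm t by (simp add: prediction_algorithm_def)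
    then have "weight k f c a t i \<le> weight k f c a t (p t)"
      using i by (auto simp: is_arg_max_linorder)
    then show ?thesis
      unfolding wt[OF i] wt[OF p_arm[OF t]] using M_pos by (simp add: divide_le_cancel)
  qed
  have "K t = (\<Union>i\<in>{1..k}. K t \<inter> B i)"
  proof -
    have "\<exists>i\<in>{1..k}. w \<in> B i" if w: "w \<in> K t" for w
    proof -
      have "Max ((\<lambda>i. w i - c t i) ` {1..k}) \<in> (\<lambda>i. w i - c t i) ` {1..k}"
        using k_pos by (intro Max_in) auto
      then obtain i where "i \<in> {1..k}" "w i - c t i = Max ((\<lambda>i. w i - c t i) ` {1..k})" by auto
      then have "i \<in> {1..k}" "\<forall>j\<in>{1..k}. w j - c t j \<le> w i - c t i" by auto
      then show ?thesis using w K_cube cube_rvec by (auto simp: B_def)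
    qed
    then show ?thesis by auto
  qed
  then have "measure (M t) (K t) \<le> (\<Sum>i\<in>{1..k}. measure (M t) (K t \<inter> B i))"
    using measure_UNION_le[of "{1..k}" "\<lambda>i. K t \<inter> B i" "M t"] B K_sets M_basic(1) by auto
  also have "\<dots> \<le> (\<Sum>i\<in>{1..k}. measure (M t) (K t \<inter> B (p t)))"
    by (intro sum_mono le)
  also have "\<dots> = real k * measure (M t) (K t \<inter> B (p t))" by simp
  also have "measure (M t) (K t \<inter> B (p t)) \<le> measure (M t) {w \<in> K t. gap t \<le> dev (p t) (a t) w}"
  proof (rule measure_mono_fmeasurable)
    show "K t \<inter> B (p t) \<subseteq> {w \<in> K t. gap t \<le> dev (p t) (a t) w}"
      using a_arm[OF t] by (auto simp: B_def gap_def dev_def) (smt (verit) atLeastAtMost_iff)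
    show "K t \<inter> B (p t) \<in> sets (M t)" using B[OF p_arm[OF t]] K_sets M_basic(1) by auto
    show "{w \<in> K t. gap t \<le> dev (p t) (a t) w} \<in> fmeasurable (M t)"
      using sets_dev[OF t] by (intro M_fmeasurable) auto
  qed
  finally show ?thesis using k_pos by (simp add: divide_le_eq mult.commute mult_left_mono)
qed

text \<open>Contracting \<open>K t\<close> towards \<open>v\<close> by the factor \<open>1 - s\<close> loses only a fraction \<open>k * s\<close> of the mass.\<close>

lemma mass_below:
  assumes s: "0 < s" "s < 1" and g: "0 < gap t"
  shows "(1 - real k * s) * measure (M t) {w \<in> K t. dev (p t) (a t) w < gap t / (1 - s)}
      \<le> (1 - 1 / real k) * measure (M t) (K t)"
proof -
  let ?D = "dev (p t) (a t)"
  let ?lo = "\<lambda>x. {w \<in> K t. ?D w < x}"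
  obtain d where d: "d \<le> k" and contr: "\<And>S S' z m. S \<in> sets (lborel_rvec k) \<Longrightarrow>
      S' \<in> sets (lborel_rvec k) \<Longrightarrow> S \<subseteq> K t \<Longrightarrow> S' \<subseteq> K t \<Longrightarrow>
        z \<in> K t \<Longrightarrow> 0 < m \<Longrightarrow> (\<And>x. x \<in> S \<Longrightarrow> mix k m z x \<in> S') \<Longrightarrow>
        m ^ d * measure (M t) S \<le> measure (M t) S'"
    by (rule M_props) blast
  \<comment> \<open>Bernoulli's inequality turns the volume factor \<open>(1 - s) ^ d\<close> into a
    linear loss, uniformly in the dimension \<open>d \<le> k\<close>.\<close>
  have "1 - real k * s \<le> 1 - real d * s" using d s by (simp add: mult_right_mono)
  also have "\<dots> \<le> (1 - s) ^ d"
    using Bernoulli_inequality[of "- s" d] s by simp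
  finally have "(1 - real k * s) * measure (M t) (?lo (gap t / (1 - s)))
      \<le> (1 - s) ^ d * measure (M t) (?lo (gap t / (1 - s)))"
    by (intro mult_right_mono) auto
  also have "\<dots> \<le> measure (M t) (?lo (gap t))"
  proof (rule contr)
    show "?lo (gap t / (1 - s)) \<in> sets (lborel_rvec k)" "?lo (gap t) \<in> sets (lborel_rvec k)"
      by (rule sets_dev[OF t])+
    show "mix k (1 - s) v x \<in> ?lo (gap t)" if x: "x \<in> ?lo (gap t / (1 - s))" for x
    proof -
      have "mix k (1 - s) v x \<in> K t" using x s v_in by (intro convex_rvec_mixD[OF K_convex]) auto
      moreover have "?D (mix k (1 - s) v x) = (1 - s) * ?D x"
        using p_arm[OF t] a_arm[OF t] by (simp add: dev_mix)
      moreover have "(1 - s) * ?D x < gap t"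
        using x s by (simp add: pos_less_divide_eq mult.commute)
      ultimately show ?thesis by simp
    qed
  qed (use s v_in in auto)
  also have "measure (M t) (?lo (gap t)) = measure (M t) (K t - {w \<in> K t. gap t \<le> ?D w})"
    by (intro arg_cong[of _ _ "measure (M t)"]) auto
  also have "\<dots> = measure (M t) (K t) - measure (M t) {w \<in> K t. gap t \<le> ?D w}"
    using M_basic sets_dev[OF t] K_sets by (intro measure_Diff) auto
  also have "\<dots> \<le> measure (M t) (K t) - measure (M t) (K t) / real k"
    using prediction_mass by simp
  finally show ?thesis by (simp add: left_diff_distrib)
qed

lemma hit_mass:
  assumes g: "0 < gap t"
  shows "measure (M t) (K t) / (2 * real k) \<le> measure (M t) (hit t)"
proof -
  let ?q = "measure (M t) {w \<in> K t. dev (p t) (a t) w < gap t / (1 - hit_slack)}"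
  have k: "real k \<ge> 1" using k_pos by simp
  have "(1 - real k * hit_slack) * ?q \<le> (1 - 1 / real k) * measure (M t) (K t)"
    using hit_slack_bounds by (intro mass_below g) auto
  then have "(1 - 1 / (2 * real k)) * ?q \<le> (1 - 1 / real k) * measure (M t) (K t)"
    by (simp only: hit_slack_bounds(3))
  \<comment> \<open>Splitting off one factor \<open>1 - 1 / (2 * k)\<close> to cancel it leaves the
    same factor as the bound on the complement of \<open>hit t\<close>.\<close>
  also have "1 - 1 / real k \<le> (1 - 1 / (2 * real k)) * (1 - 1 / (2 * real k))"
    using k by (simp add: field_simps)
  finally have "(1 - 1 / (2 * real k)) * ?q
      \<le> (1 - 1 / (2 * real k)) * ((1 - 1 / (2 * real k)) * measure (M t) (K t))"
    by (simp add: mult_right_mono)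
  moreover have "0 < 1 - 1 / (2 * real k)" using k by (simp add: field_simps)
  ultimately have q: "?q \<le> (1 - 1 / (2 * real k)) * measure (M t) (K t)"
    by (simp only: mult_le_cancel_left_pos)
  have "?q = measure (M t) (K t - hit t)"
    by (intro arg_cong[of _ _ "measure (M t)"]) (auto simp: hit_def)
  also have "\<dots> = measure (M t) (K t) - measure (M t) (hit t)"
    using M_basic hit_sets[OF t] K_sets by (intro measure_Diff) (auto simp: hit_def)
  finally show ?thesis using q by (simp add: left_diff_distrib)
qed

text \<open>For \<open>s = 3 / 2 * hit_slack\<close> the lost fraction
  \<open>k * s = 3 / (4 * k)\<close> is still below \<open>1 / k\<close>, so \<open>K t\<close>
  reaches beyond the threshold. This threshold exceeds that of \<open>hit t\<close>, so removing
  \<open>hit t\<close> shortens the extent by a definite factor.\<close>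

lemma deep_point:
  assumes g: "0 < gap t"
  shows "\<exists>w\<in>K t. gap t / (1 - 3 / 2 * hit_slack) \<le> dev (p t) (a t) w"
proof (rule ccontr)
  assume "\<not> ?thesis"
  then have "{w \<in> K t. dev (p t) (a t) w < gap t / (1 - 3 / 2 * hit_slack)} = K t"
    by (auto simp: not_le)
  then have "(1 - real k * (3 / 2 * hit_slack)) * measure (M t) (K t) \<le> (1 - 1 / real k) * measure (M t) (K t)"
    using mass_below[of "3 / 2 * hit_slack"] hit_slack_bounds(1,2) g by simp
  moreover have "real k * (3 / 2 * hit_slack) = 3 / 2 * (1 / (2 * real k))"
    using hit_slack_bounds(3) by (metis mult.left_commute)
  ultimately have "1 - 3 / 2 * (1 / (2 * real k)) \<le> 1 - 1 / real k"
    using M_pos by (simp only: mult_le_cancel_right_pos)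
  then show False using k_pos by (simp add: field_simps)
qed

end

section \<open>Extents when the whole hit set is removed\<close>

text \<open>Each such time contributes at most the current extent \<open>X\<close> and reduces it to
  at most \<open>(1 - hit_slack / 2) * X\<close>. The geometric series has the factor
  \<open>2 / hit_slack = 4 * k^2\<close>.\<close>

lemma width_bound:
  assumes "1 \<le> n" and v: "\<And>t. v \<in> K t" and X: "\<And>w. w \<in> K n \<Longrightarrow> dev i j w \<le> X"
  shows "(\<Sum>t | t \<in> {n..T} \<and> 0 < gap t \<and> hit t \<inter> K (Suc t) = {} \<and> p t = i \<and> a t = j. gap t)
      \<le> 4 * (real k)\<^sup>2 * X"
proof -
  let ?S = "\<lambda>n. {t \<in> {n..T}. 0 < gap t \<and> hit t \<inter> K (Suc t) = {} \<and> p t = i \<and> a t = j}"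
  have k: "(real k)\<^sup>2 \<ge> 1" using k_pos by (simp add: one_le_power)
  have "(\<Sum>t\<in>?S n. gap t) \<le> 4 * (real k)\<^sup>2 * X"
    using assms(1) X
  proof (induction "Suc T - n" arbitrary: n X)
    case 0
    then have "?S n = {}" by auto
    moreover have "0 \<le> X" using 0(3)[OF v] by simp
    ultimately show ?case by (simp only: sum.empty) simp
  next
    case (Suc m)
    have m: "m = Suc T - Suc n" "n \<le> T" using Suc.hyps(2) by auto
    have X0: "0 \<le> X" using Suc.prems(2)[OF v] by simp
    show ?case
    proof (cases "n \<in> ?S n")
      case False
      then have "?S n = ?S (Suc n)" using m by (auto simp: Suc_le_eq le_less)
      moreover have "(\<Sum>t\<in>?S (Suc n). gap t) \<le> 4 * (real k)\<^sup>2 * X"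
        using K_antimono[of n "Suc n"] Suc.prems by (intro Suc.hyps(1)[OF m(1)]) auto
      ultimately show ?thesis by simp
    next
      case True
      then have n: "0 < gap n" "hit n \<inter> K (Suc n) = {}" "p n = i" "a n = j" by auto
      define X' where "X' = gap n / (1 - hit_slack)"
      have "?S n = insert n (?S (Suc n))" using True by (auto simp: Suc_le_eq le_less)
      then have split: "(\<Sum>t\<in>?S n. gap t) = gap n + (\<Sum>t\<in>?S (Suc n). gap t)" by simp
      have "(\<Sum>t\<in>?S (Suc n). gap t) \<le> 4 * (real k)\<^sup>2 * X'"
      proof (rule Suc.hyps(1)[OF m(1)])
        show "dev i j w \<le> X'" if "w \<in> K (Suc n)" for w
          using n that K_antimono[of n "Suc n"] by (force simp: hit_def X'_def)
      qed simp
      then have le: "(\<Sum>t\<in>?S n. gap t) \<le> gap n + 4 * (real k)\<^sup>2 * X'"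
        unfolding split by simp
      obtain w where "w \<in> K n" "gap n / (1 - 3 / 2 * hit_slack) \<le> dev i j w"
        using deep_point[OF Suc.prems(1) v n(1)] n by auto
      then have "gap n / (1 - 3 / 2 * hit_slack) \<le> X" using Suc.prems(2) by force
      then have g: "gap n \<le> (1 - 3 / 2 * hit_slack) * X"
        using hit_slack_bounds(2) by (simp add: pos_divide_le_eq mult.commute)
      \<comment> \<open>The ratio of the thresholds of \<open>hit n\<close> and of the deep point is
        thereby at most \<open>1 - hit_slack / 2\<close>.\<close>
      moreover have "(1 - 3 / 2 * hit_slack) * X \<le> (1 - hit_slack / 2) * X * (1 - hit_slack)"
      proof -
        have "1 - 3 / 2 * hit_slack \<le> (1 - hit_slack / 2) * (1 - hit_slack)"
          using hit_slack_bounds(1) by (simp add: algebra_simps)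
        then have "(1 - 3 / 2 * hit_slack) * X \<le> ((1 - hit_slack / 2) * (1 - hit_slack)) * X"
          using X0 by (rule mult_right_mono)
        then show ?thesis by (simp only: mult_ac)
      qed
      ultimately have "gap n \<le> (1 - hit_slack / 2) * X * (1 - hit_slack)" by (rule order.trans)
      then have "X' \<le> (1 - hit_slack / 2) * X"
        unfolding X'_def using hit_slack_bounds(2) by (simp add: pos_divide_le_eq)
      then have "4 * (real k)\<^sup>2 * X' \<le> 4 * (real k)\<^sup>2 * ((1 - hit_slack / 2) * X)"
        by (intro mult_left_mono) auto
      \<comment> \<open>The decrease \<open>4 * k^2 * (hit_slack / 2) * X\<close> is exactly
        \<open>X\<close>, which pays for the current gap.\<close>
      also have "\<dots> = 4 * (real k)\<^sup>2 * X - X" using k k_pos by (simp add: hit_slack_def field_simps)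
      finally have "4 * (real k)\<^sup>2 * X' \<le> 4 * (real k)\<^sup>2 * X - X" .
      moreover have "gap n \<le> X"
        using g X0 hit_slack_bounds mult_right_mono[of "1 - 3 / 2 * hit_slack" 1 X] by simp
      ultimately show ?thesis using le by simp
    qed
  qed
  then show ?thesis by simp
qed

text \<open>There are \<open>k^2\<close> pairs of arms, and each starts with an extent of at most 2
  on the cube.\<close>

lemma width_total:
  assumes v: "\<And>t. v \<in> K t"
  shows "(\<Sum>t | t \<in> {1..T} \<and> 0 < gap t \<and> hit t \<inter> K (Suc t) = {}. gap t) \<le> 8 * real k ^ 4"
proof -
  let ?S = "{t \<in> {1..T}. 0 < gap t \<and> hit t \<inter> K (Suc t) = {}}"
  let ?A = "{1..k} \<times> {1..k}"
  have "(\<Sum>t\<in>?S. gap t) = (\<Sum>x\<in>?A. \<Sum>t | t \<in> ?S \<and> (p t, a t) = x. gap t)"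
    using p_arm a_arm by (intro sum.group[symmetric]) auto
  also have "\<dots> \<le> (\<Sum>x\<in>?A. 8 * (real k)\<^sup>2)"
  proof (rule sum_mono)
    fix x assume "x \<in> ?A"
    then obtain i j where x: "x = (i, j)" "i \<in> {1..k}" "j \<in> {1..k}" by auto
    have "dev i j w \<le> 2" if w: "w \<in> K 1" for w
    proof -
      have "w \<in> unit_cube k" using w K_cube by blast
      then show ?thesis
        using unit_cube_bounds[OF _ x(2)] unit_cube_bounds[OF _ x(3)] v_cube
        unfolding dev_def by (smt (verit))
    qed
    then have "(\<Sum>t | t \<in> {1..T} \<and> 0 < gap t \<and> hit t \<inter> K (Suc t) = {} \<and> p t = i \<and> a t = j. gap t)
       \<le> 4 * (real k)\<^sup>2 * 2"
      by (intro width_bound v) auto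
    moreover have "{t. t \<in> ?S \<and> (p t, a t) = x}
       = {t. t \<in> {1..T} \<and> 0 < gap t \<and> hit t \<inter> K (Suc t) = {} \<and> p t = i \<and> a t = j}"
      using x by auto
    ultimately show "(\<Sum>t | t \<in> ?S \<and> (p t, a t) = x. gap t) \<le> 8 * (real k)\<^sup>2" by simp
  qed
  also have "\<dots> = 8 * real k ^ 4" by (simp add: card_cartesian_product power4_eq_xxxx power2_eq_square)
  finally show ?thesis .
qed

end

subsection \<open>Epochs\<close>

lemma half_le_ln: "1 / 2 \<le> ln (real T)" if "2 \<le> T"
proof -
  have "ln (1 / 2 :: real) \<le> 1 / 2 - 1" by (intro ln_le_minus_one) simp
  then have "1 / 2 \<le> ln (2 :: real)" by (simp add: ln_div)
  also have "\<dots> \<le> ln (real T)" using that by simp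
  finally show ?thesis .
qed

context prediction_game
begin

text \<open>Undoing the contraction is an affine operation, so the hull of \<open>K t\<close>
  contains \<open>K n\<close>. Hence the reference measure stays the same and volumes at different
  times can be compared.\<close>

lemma hull_contraction_eq:
  assumes z: "z \<in> K t" and l: "0 < l" "n \<le> t" and sub: "\<And>u. u \<in> K n \<Longrightarrow> mix k l z u \<in> K t"
  shows "affine_rvec k hull K t = affine_rvec k hull K n"
proof (rule antisym)
  show "affine_rvec k hull K t \<subseteq> affine_rvec k hull K n"
    by (rule hull_mono[OF K_antimono[OF l(2)]])
  have R: "K s \<subseteq> rvec k" for s using K_cube cube_rvec by blast
  have "K n \<subseteq> affine_rvec k hull K t"
  proof
    fix u assume u: "u \<in> K n"
    have "mix k (1 / l) z (mix k l z u) \<in> affine_rvec k hull K t"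
      by (rule affine_rvec_mixD[OF affine_rvec_hull[OF R]]) (intro hull_inc z sub[OF u])+
    also have "mix k (1 / l) z (mix k l z u) = u"
      using u R l by (intro rvec_eqI[of _ k]) (auto simp: field_simps)
    finally show "u \<in> affine_rvec k hull K t" .
  qed
  then show "affine_rvec k hull K n \<subseteq> affine_rvec k hull K t"
    using affine_rvec_hull[OF R] by (rule hull_minimal)
qed

text \<open>Constraints before \<open>n\<close> hold for both \<open>z\<close> and \<open>u\<close>,
  hence for their mix. For a later one, \<open>cum\<close> differs by at most \<open>2 * T\<close>
  on the cube, so by convexity the ratio \<open>1 / (2 * T^2)\<close> uses up at most the slack
  \<open>1 / T\<close>.\<close>

lemma contraction_stays:
  assumes T: "1 \<le> T" and nm: "1 \<le> n" "n \<le> m" "m \<le> T"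
    and z: "z \<in> K m" and slack: "\<And>s. s \<in> {n..<m} \<Longrightarrow> cum s z \<le> f s - 1 / real T"
    and u: "u \<in> K n"
  shows "mix k (1 / (2 * (real T)\<^sup>2)) z u \<in> K m"
proof -
  let ?l = "1 / (2 * (real T)\<^sup>2)"
  have "1 \<le> (real T)\<^sup>2" using T by (simp add: one_le_power)
  then have l: "0 \<le> ?l" "?l \<le> 1" by (auto simp: divide_le_eq_1)
  have zn: "z \<in> K n" using z K_antimono[OF nm(2)] by blast
  have "cum s (mix k ?l z u) \<le> f s" if s: "s \<in> {1..<m}" for s
  proof (cases "s < n")
    case True
    have "mix k ?l z u \<in> K n" using zn u l by (intro convex_rvec_mixD[OF K_convex]) auto
    then show ?thesis using True s by (auto simp: K_iff)
  next
    case False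
    have "cum s (mix k ?l z u) \<le> (1 - ?l) * cum s z + ?l * cum s u"
      by (rule cum_mix[OF l])
    also have "\<dots> = cum s z + ?l * (cum s u - cum s z)" by (simp add: algebra_simps)
    also have "\<dots> \<le> cum s z + ?l * (2 * real T)"
    proof -
      have "cum s u \<le> cum s z + 2 * real s"
        using zn u K_cube by (intro cum_lipschitz) auto
      then have "cum s u - cum s z \<le> 2 * real T" using s nm by simp
      then show ?thesis using l by (intro add_left_mono mult_left_mono)
    qed
    also have "?l * (2 * real T) = 1 / real T" using T by (simp add: power2_eq_square)
    also have "cum s z + 1 / real T \<le> f s" using slack[of s] s False by simp
    finally show ?thesis by simp
  qed
  moreover have "mix k ?l z u \<in> unit_cube k"
    using zn u l K_cube by (intro mix_cube) auto
  ultimately show ?thesis by (simp add: K_iff)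
qed

definition surviving :: "nat set" where
  "surviving = {t. 0 < gap t \<and> hit t \<inter> K (Suc t) \<noteq> {}}"

text \<open>\<open>b\<close> is regret already incurred before the epoch, so \<open>f m - b\<close>
  is the available budget. It counts twice because membership of \<open>w\<close> in
  \<open>K t\<close> controls only the charges before \<open>t\<close>; the one at \<open>t\<close>
  is controlled through a point of \<open>hit t\<close> that stays in
  \<open>K (Suc t)\<close>.\<close>

lemma charge_bound:
  assumes v: "\<And>t. v \<in> K t"
    and n: "1 \<le> n" "n \<le> t" and tm: "t \<le> m" and F: "\<And>w. w \<in> K n \<Longrightarrow> b \<le> cum (n - 1) w"
    and w: "w \<in> K t"
  shows "(\<Sum>s=n..t. (if s \<in> surviving then gap s * hit_slack else 0) * indicator (hit s) w)
       \<le> 2 * (f m - b)"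
proof -
  let ?w = "\<lambda>s. if s \<in> surviving then gap s * hit_slack else 0"
  have pen: "?w s * indicator (hit s) x \<le> pen s x" if "1 \<le> s" for s x
    using that pen_hit[of s x] pen_nonneg[OF that, of x]
    by (auto simp: surviving_def indicator_def)
  have split: "(\<Sum>s=n..l. pen s x) = cum l x - cum (n - 1) x" if "n \<le> Suc l" for l x
  proof -
    have "n - 1 \<le> l" using that by simp
    then show ?thesis
      by (induction l rule: dec_induct) (use n in \<open>auto simp: cum_Suc\<close>)
  qed
  have budget: "cum l x - cum (n - 1) x \<le> f m - b" if "x \<in> K (Suc l)" "n \<le> l" "l \<le> m" for l x
  proof -
    have "cum l x \<le> f l" using that n by (auto simp: K_iff)
    moreover have "f l \<le> f m" using that n by (intro f_mono) auto
    moreover have "x \<in> K n" using that K_antimono[of n "Suc l"] by auto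
    ultimately show ?thesis using F[of x] by simp
  qed
  have F0: "0 \<le> f m - b"
    using budget[of v n] v cum_mono[of "n - 1" n v] n tm by simp
  have "(\<Sum>s=n..<t. ?w s * indicator (hit s) w) + ?w t * indicator (hit t) w \<le> (f m - b) + (f m - b)"
  proof (rule add_mono)
    show "(\<Sum>s=n..<t. ?w s * indicator (hit s) w) \<le> f m - b"
    proof (cases "n = t")
      case True
      then show ?thesis using F0 by simp
    next
      case False
      have "(\<Sum>s=n..<t. ?w s * indicator (hit s) w) \<le> (\<Sum>s=n..t - 1. pen s w)"
      proof -
        have "{n..<t} = {n..t - 1}" using False n by auto
        then show ?thesis using n by (simp only:) (intro sum_mono pen, auto)
      qed
      also have "\<dots> = cum (t - 1) w - cum (n - 1) w" using False n by (intro split) auto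
      also have "\<dots> \<le> f m - b" using False n tm w by (intro budget) auto
      finally show ?thesis .
    qed
    show "?w t * indicator (hit t) w \<le> f m - b"
    proof (cases "t \<in> surviving \<and> w \<in> hit t")
      case True
      then obtain x where x: "x \<in> hit t" "x \<in> K (Suc t)" by (auto simp: surviving_def)
      have t1: "1 \<le> t" using n by simp
      \<comment> \<open>The charge is constant on \<open>hit t\<close>, so it can be read off at the
        surviving point \<open>x\<close>.\<close>
      have "?w t * indicator (hit t) w = ?w t * indicator (hit t) x" using True x by simp
      also have "\<dots> \<le> pen t x" using pen[OF t1] .
      also have "\<dots> \<le> (\<Sum>s=n..t. pen s x)"
        using n by (intro member_le_sum) (auto intro: pen_nonneg)
      also have "\<dots> = cum t x - cum (n - 1) x" using n by (intro split) auto
      also have "\<dots> \<le> f m - b" using x n tm by (intro budget) auto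
      finally show ?thesis .
    next
      case False
      then show ?thesis using F0 by auto
    qed
  qed
  moreover have "(\<Sum>s=n..t. ?w s * indicator (hit s) w)
      = (\<Sum>s=n..<t. ?w s * indicator (hit s) w) + ?w t * indicator (hit t) w"
    using n by (simp add: sum.last_plus atLeastLessThanSuc_atLeastAtMost[symmetric])
  ultimately show ?thesis by simp
qed

text \<open>Charging applies with weights \<open>gap t * hit_slack\<close> and
  \<open>G = 2 * (f m - b)\<close>. The slack point \<open>z\<close> bounds the volume ratio by
  \<open>(2 * T^2) ^ d\<close>, which gives the logarithm.\<close>

lemma epoch_bound:
  assumes v: "\<And>t. v \<in> K t" and T: "2 \<le> T" and nm: "1 \<le> n" "n \<le> m" "m \<le> T"
    and z: "z \<in> K m" and slack: "\<And>s. s \<in> {n..<m} \<Longrightarrow> cum s z \<le> f s - 1 / real T"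
    and b: "\<And>w. w \<in> K n \<Longrightarrow> b \<le> cum (n - 1) w"
  shows "(\<Sum>t | t \<in> {n..m} \<and> t \<in> surviving. gap t)
    \<le> 8 * real k ^ 3 * (1 + real k * ln (2 * (real T)\<^sup>2)) * (f m - b)"
proof -
  let ?l = "1 / (2 * (real T)\<^sup>2)"
  let ?w = "\<lambda>s. if s \<in> surviving then gap s * hit_slack else 0"
  let ?L = "ln (2 * (real T)\<^sup>2)"
  have l0: "0 < ?l" using T by simp
  have T2: "1 \<le> 2 * (real T)\<^sup>2" using T one_le_power[of "real T" 2] by linarith
  have mem: "mix k ?l z u \<in> K t" if "u \<in> K n" "t \<in> {n..m}" for u t
    using contraction_stays[OF _ nm z slack that(1)] T K_antimono[of t m] that(2) by auto
  have zt: "z \<in> K t" if "t \<in> {n..m}" for t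
    using z K_antimono[of t m] that by auto
  have MM: "M t = M n" if "t \<in> {n..m}" for t
    using hull_contraction_eq[OF zt[OF that] l0, of n] that mem by auto
  have pos: "0 < measure (M n) (K t)" if "t \<in> {n..m}" for t
    using M_pos[of t] v nm that MM[OF that] by auto
  obtain d where d: "d \<le> k" and contr: "\<And>S S' z m. S \<in> sets (lborel_rvec k) \<Longrightarrow>
      S' \<in> sets (lborel_rvec k) \<Longrightarrow> S \<subseteq> K n \<Longrightarrow> S' \<subseteq> K n \<Longrightarrow>
        z \<in> K n \<Longrightarrow> 0 < m \<Longrightarrow> (\<And>x. x \<in> S \<Longrightarrow> mix k m z x \<in> S') \<Longrightarrow>
        m ^ d * measure (M n) S \<le> measure (M n) S'"
    by (rule M_props[OF nm(1) v]) blast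
  have vol: "?l ^ d * measure (M n) (K n) \<le> measure (M n) (K m)"
    using nm mem zt l0 K_antimono[OF nm(2)] by (intro contr K_sets) auto
  have "measure (M n) (K n) / measure (M n) (K m) \<le> (2 * (real T)\<^sup>2) ^ d"
    using vol pos[of m] nm T by (simp add: power_divide divide_le_eq field_simps)
  then have "ln (measure (M n) (K n) / measure (M n) (K m)) \<le> ln ((2 * (real T)\<^sup>2) ^ d)"
    using pos[of m] pos[of n] nm T by (subst ln_le_cancel_iff) auto
  also have "\<dots> = real d * ?L" using T by (subst ln_realpow) auto
  also have "\<dots> \<le> real k * ?L" using d T2 by (intro mult_right_mono ln_ge_zero) auto
  finally have lnle: "ln (measure (M n) (K n) / measure (M n) (K m)) \<le> real k * ?L" .
  have F0: "0 \<le> f m - b"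
  proof -
    have "cum n v \<le> f n" using v[of "Suc n"] nm by (auto simp: K_iff)
    then show ?thesis
      using b[OF v] cum_mono[of "n - 1" n v] f_mono[OF nm(1,2)] by simp
  qed
  have "(\<Sum>t=n..m. ?w t / (2 * real k))
      \<le> (\<Sum>t=n..m. ?w t * measure (M n) (hit t) / measure (M n) (K t))"
  proof (rule sum_mono)
    fix t assume t: "t \<in> {n..m}"
    show "?w t / (2 * real k) \<le> ?w t * measure (M n) (hit t) / measure (M n) (K t)"
    proof (cases "t \<in> surviving")
      case True
      then have g: "0 < gap t" by (simp add: surviving_def)
      then have "measure (M n) (K t) / (2 * real k) \<le> measure (M n) (hit t)"
        using hit_mass[of t] v nm t MM[OF t] by auto
      then have "1 / (2 * real k) \<le> measure (M n) (hit t) / measure (M n) (K t)"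
        using pos[OF t] by (simp add: le_divide_eq)
      then have "?w t * (1 / (2 * real k)) \<le> ?w t * (measure (M n) (hit t) / measure (M n) (K t))"
        using g hit_slack_bounds(1) by (intro mult_left_mono) auto
      then show ?thesis by simp
    qed simp
  qed
  also have "\<dots> \<le> 2 * (f m - b) * (1 + ln (measure (M n) (K n) / measure (M n) (K m)))"
  proof (rule charge_le_log_measure[OF nm(2)])
    show "K t \<in> sets (M n)" for t using M_basic(1)[OF nm(1) v] K_sets by simp
    show "emeasure (M n) (K t) < \<infinity>" if "t \<in> {n..m}" for t
      using M_basic(3)[of t] v nm that MM[OF that] by auto
    show "hit t \<in> sets (M n)" if "t \<in> {n..m}" for t
      using M_basic(1)[OF nm(1) v] hit_sets[of t] nm that by auto
    show "0 \<le> ?w t" for t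
      using hit_slack_bounds(1) by (auto simp: surviving_def)
    show "(\<Sum>s=n..t. ?w s * indicator (hit s) x) \<le> 2 * (f m - b)" if "t \<in> {n..m}" "x \<in> K t" for t x
      using that nm b by (intro charge_bound v) auto
  qed (use pos F0 K_antimono in \<open>auto simp: hit_def\<close>)
  also have "\<dots> \<le> 2 * (f m - b) * (1 + real k * ?L)"
    using lnle F0 by (intro mult_left_mono) auto
  finally have "(\<Sum>t=n..m. ?w t / (2 * real k)) \<le> 2 * (f m - b) * (1 + real k * ?L)" .
  \<comment> \<open>\<open>hit_slack / (2 * k) = 1 / (4 * k^3)\<close>: one factor from the regret
    margin, one from the mass of \<open>hit t\<close>.\<close>
  moreover have "(\<Sum>t=n..m. ?w t / (2 * real k))
     = (\<Sum>t | t \<in> {n..m} \<and> t \<in> surviving. gap t) / (4 * real k ^ 3)"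
  proof -
    have "(\<Sum>t=n..m. ?w t / (2 * real k))
        = (\<Sum>t=n..m. if t \<in> surviving then gap t / (4 * real k ^ 3) else 0)"
      by (intro sum.cong) (auto simp: hit_slack_def power3_eq_cube power2_eq_square)
    also have "\<dots> = (\<Sum>t | t \<in> {n..m} \<and> t \<in> surviving. gap t / (4 * real k ^ 3))"
      by (subst sum.inter_filter[symmetric]) auto
    finally show ?thesis by (simp add: sum_divide_distrib)
  qed
  ultimately have "(\<Sum>t | t \<in> {n..m} \<and> t \<in> surviving. gap t) / (4 * real k ^ 3)
      \<le> 2 * (f m - b) * (1 + real k * ?L)" by simp
  then have "(\<Sum>t | t \<in> {n..m} \<and> t \<in> surviving. gap t)
      \<le> 2 * (f m - b) * (1 + real k * ?L) * (4 * real k ^ 3)"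
    using k_pos by (simp add: pos_divide_le_eq)
  also have "\<dots> = 8 * real k ^ 3 * (1 + real k * ?L) * (f m - b)" by simp
  finally show ?thesis .
qed

text \<open>The last factor is a potential. An epoch from \<open>n\<close> to \<open>m\<close> costs
  \<open>f m - b\<close>, and the next one starts with \<open>b = f n - 1 / T\<close>. The term
  \<open>f T - f n\<close> pays for the lag of the new \<open>b\<close> behind \<open>f m\<close>,
  and the last term pays for the losses \<open>1 / T\<close>, as an epoch lasts at least one
  step.\<close>

lemma epochs_total:
  assumes v: "\<And>t. v \<in> K t" and T: "2 \<le> T" and n: "1 \<le> n" "n \<le> T"
    and b: "\<And>w. w \<in> K n \<Longrightarrow> b \<le> cum (n - 1) w"
  shows "(\<Sum>t | t \<in> {n..T} \<and> t \<in> surviving. gap t)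
    \<le> 8 * real k ^ 3 * (1 + real k * ln (2 * (real T)\<^sup>2))
        * ((f T - b) + (f T - f n) + real (T - n) / real T)"
  using n b
proof (induction "T - n" arbitrary: n b rule: less_induct)
  case less
  let ?B = "8 * real k ^ 3 * (1 + real k * ln (2 * (real T)\<^sup>2))"
  let ?sum = "\<lambda>A. \<Sum>t | t \<in> A \<and> t \<in> surviving. gap t"
  have B0: "0 \<le> ?B"
  proof -
    have "1 \<le> 2 * (real T)\<^sup>2" using T one_le_power[of "real T" 2] by linarith
    then show ?thesis by (intro mult_nonneg_nonneg add_nonneg_nonneg ln_ge_zero) auto
  qed
  \<comment> \<open>An epoch starting at \<open>n\<close> may last until \<open>t\<close>. The
    condition is vacuous at \<open>t = n\<close>, and the epoch is taken as long as
    possible.\<close>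
  define good where "good t \<longleftrightarrow> n \<le> t \<and> t \<le> T \<and> (\<exists>z\<in>K t. \<forall>s\<in>{n..<t}. cum s z \<le> f s - 1 / real T)" for t
  have gn: "good n" using v[of n] less.prems by (auto simp: good_def)
  define m where "m = Greatest good"
  have gm: "good m"
    unfolding m_def using GreatestI_nat[of good n T] gn by (auto simp: good_def)
  then obtain z where m: "n \<le> m" "m \<le> T" and z: "z \<in> K m" "\<And>s. s \<in> {n..<m} \<Longrightarrow> cum s z \<le> f s - 1 / real T"
    by (auto simp: good_def)
  have epoch: "?sum {n..m} \<le> ?B * (f m - b)"
    by (rule epoch_bound[OF v T less.prems(1) m z less.prems(3)])
  show ?case
  proof (cases "m = T")
    case True
    have "?B * (f m - b) \<le> ?B * ((f T - b) + (f T - f n) + real (T - n) / real T)"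
    proof (intro mult_left_mono B0)
      have "0 \<le> real (T - n) / real T" by simp
      then show "f m - b \<le> (f T - b) + (f T - f n) + real (T - n) / real T"
        unfolding True using f_mono[OF less.prems(1,2)] by linarith
    qed
    then show ?thesis using epoch True by simp
  next
    case False
    then have mT: "Suc m \<le> T" using m by simp
    have "\<not> good (Suc m)"
      using Greatest_le_nat[of good "Suc m" T] unfolding m_def[symmetric] by (auto simp: good_def)
    then have tight: "\<exists>s\<in>{n..m}. f s - 1 / real T < cum s w" if "w \<in> K (Suc m)" for w
      using that m mT by (auto simp: good_def not_le atLeastLessThanSuc_atLeastAtMost)
    \<comment> \<open>By maximality every remaining point nearly exhausts some constraint of the
      epoch. By monotonicity its regret up to \<open>m\<close> is then at least
      \<open>f n - 1 / T\<close>.\<close>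
    have "f n - 1 / real T \<le> cum (Suc m - 1) w" if w: "w \<in> K (Suc m)" for w
    proof -
      obtain s where s: "s \<in> {n..m}" "f s - 1 / real T < cum s w" using tight[OF w] by blast
      then have "f n \<le> f s" "cum s w \<le> cum m w" using less.prems(1) by (auto intro: f_mono cum_mono)
      then show ?thesis using s by simp
    qed
    then have IH: "?sum {Suc m..T}
        \<le> ?B * ((f T - (f n - 1 / real T)) + (f T - f (Suc m)) + real (T - Suc m) / real T)"
      using mT m less.prems by (intro less.hyps) auto
    have "{t. t \<in> {n..T} \<and> t \<in> surviving}
        = {t. t \<in> {n..m} \<and> t \<in> surviving} \<union> {t. t \<in> {Suc m..T} \<and> t \<in> surviving}"
      using m by auto
    then have "?sum {n..T} = ?sum {n..m} + ?sum {Suc m..T}"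
      by (simp only:) (subst sum.union_disjoint, auto)
    also have "\<dots> \<le> ?B * (f m - b)
        + ?B * ((f T - (f n - 1 / real T)) + (f T - f (Suc m)) + real (T - Suc m) / real T)"
      by (rule add_mono[OF epoch IH])
    also have "\<dots> = ?B * ((f m - b) + ((f T - (f n - 1 / real T)) + (f T - f (Suc m)) + real (T - Suc m) / real T))"
      by (simp only: distrib_left)
    also have "\<dots> \<le> ?B * ((f T - b) + (f T - f n) + real (T - n) / real T)"
    proof (rule mult_left_mono[OF _ B0])
      have "f m \<le> f (Suc m)" using m less.prems(1) by (intro f_mono) auto
      moreover have "1 / real T + real (T - Suc m) / real T \<le> real (T - n) / real T"
        using m mT T by (simp add: add_divide_distrib[symmetric] divide_right_mono)
      ultimately show "(f m - b) + ((f T - (f n - 1 / real T)) + (f T - f (Suc m)) + real (T - Suc m) / real T)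
        \<le> (f T - b) + (f T - f n) + real (T - n) / real T" by linarith
    qed
    finally show ?thesis .
  qed
qed

text \<open>The constant 96 is 16 for the removed hit sets plus 80 for the surviving ones.\<close>

lemma total_gap:
  assumes v: "\<And>t. v \<in> K t" and T: "2 \<le> T"
  shows "(\<Sum>t=1..T. gap t) \<le> 96 * real k ^ 4 * (f T + 1) * ln (real T)"
proof -
  let ?W = "{t. t \<in> {1..T} \<and> 0 < gap t \<and> hit t \<inter> K (Suc t) = {}}"
  let ?N = "{t. t \<in> {1..T} \<and> t \<in> surviving}"
  let ?L = "ln (2 * (real T)\<^sup>2)"
  have k1: "1 \<le> real k" using k_pos by simp
  have lnT: "ln 2 \<le> ln (real T)" using T by simp
  have f: "0 \<le> f 1" "f 1 \<le> f T"
  proof -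
    have "cum 1 v \<le> f 1" using v[of 2] by (auto simp: K_iff)
    moreover have "0 \<le> cum 1 v" using pen_nonneg[of 1 v] by (simp add: cum_def)
    ultimately show "0 \<le> f 1" by simp
    show "f 1 \<le> f T" using T by (intro f_mono) auto
  qed
  have L: "?L \<le> 3 * ln (real T)"
    using T lnT by (simp add: ln_mult ln_realpow)
  have "1 \<le> 2 * (real T)\<^sup>2" using T one_le_power[of "real T" 2] by linarith
  then have L0: "0 \<le> 1 + real k * ?L" by (intro add_nonneg_nonneg mult_nonneg_nonneg ln_ge_zero) auto
  \<comment> \<open>Nonpositive gaps are dropped; the positive ones split according to whether
    \<open>hit t\<close> loses all its points.\<close>
  have "(\<Sum>t=1..T. gap t) \<le> (\<Sum>t\<in>{1..T}. (if t \<in> ?W then gap t else 0) + (if t \<in> ?N then gap t else 0))"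
    by (intro sum_mono) (auto simp: surviving_def)
  also have "\<dots> = (\<Sum>t\<in>?W. gap t) + (\<Sum>t\<in>?N. gap t)"
  proof -
    have "(\<Sum>t\<in>{1..T}. if t \<in> A then gap t else 0) = (\<Sum>t\<in>A. gap t)" if "A \<subseteq> {1..T}" for A
      using that by (simp add: sum.inter_restrict[symmetric] Int_absorb1)
    from this[of ?W] this[of ?N] show ?thesis unfolding sum.distrib by fastforce
  qed
  also have "(\<Sum>t\<in>?W. gap t) \<le> 8 * real k ^ 4" by (rule width_total[OF v])
  \<comment> \<open>The first epoch starts at time 1 with nothing spent, so
    \<open>b = 0\<close>.\<close>
  also have "(\<Sum>t\<in>?N. gap t)
      \<le> 8 * real k ^ 3 * (1 + real k * ?L) * ((f T - 0) + (f T - f 1) + real (T - 1) / real T)"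
    using T by (intro epochs_total v) (auto simp: cum_def)
  also have "\<dots> \<le> 8 * real k ^ 3 * (real k * (5 * ln (real T))) * (2 * (f T + 1))"
  proof (intro mult_mono mult_left_mono)
    have "1 \<le> real k * (2 * ln (real T))"
      using k1 half_le_ln[OF T] mult_mono[of 1 "real k" 1 "2 * ln (real T)"] by simp
    moreover have "real k * ?L \<le> real k * (3 * ln (real T))" using L by (intro mult_left_mono) auto
    ultimately show "1 + real k * ?L \<le> real k * (5 * ln (real T))" by (simp add: algebra_simps)
    have "real (T - 1) / real T \<le> 1" using T by (simp add: divide_le_eq)
    then show "(f T - 0) + (f T - f 1) + real (T - 1) / real T \<le> 2 * (f T + 1)" using f by simp
    show "0 \<le> (f T - 0) + (f T - f 1) + real (T - 1) / real T" using f by simp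
  qed (use half_le_ln[OF T] L0 in auto)
  also have "\<dots> = 80 * real k ^ 4 * (f T + 1) * ln (real T)"
    by (simp add: power4_eq_xxxx power3_eq_cube)
  also have "8 * real k ^ 4 \<le> 16 * real k ^ 4 * (f T + 1) * ln (real T)"
  proof -
    have "1 * (1/2) \<le> (f T + 1) * ln (real T)" using f half_le_ln[OF T] by (intro mult_mono) auto
    then have "16 * real k ^ 4 * (1 / 2) \<le> 16 * real k ^ 4 * ((f T + 1) * ln (real T))"
      by (intro mult_left_mono) auto
    then show ?thesis by (simp add: mult.assoc)
  qed
  finally show ?thesis by (simp add: algebra_simps)
qed

end

theorem theorem1:
  "\<exists>C::real. C > 0 \<and>
     (\<forall>(k::nat) (f :: nat \<Rightarrow> real) (v :: nat \<Rightarrow> real) (c :: nat \<Rightarrow> nat \<Rightarrow> real)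
        (a :: nat \<Rightarrow> nat) (opt :: nat \<Rightarrow> nat) (p :: nat \<Rightarrow> nat).
        mono_on {1..} f \<longrightarrow>
        v \<in> unit_cube k \<longrightarrow>
        (\<forall>t\<ge>1. a t \<in> {1..k}) \<longrightarrow>
        (\<forall>t\<ge>1. best_arm k v (c t) (opt t)) \<longrightarrow>
        (\<forall>\<tau>\<ge>1. (\<Sum>t=1..\<tau>. regret v (c t) (opt t) (a t)) \<le> f \<tau>) \<longrightarrow>
        prediction_algorithm k f c a p \<longrightarrow>
        (\<forall>T\<ge>2. (\<Sum>t=1..T. regret v (c t) (opt t) (p t))
                  \<le> C * real k ^ 4 * (f T + 1) * ln (real T)))"
proof (intro exI[of _ 100] conjI allI impI)
  fix k f v c a opt p and T :: nat
  assume mono: "mono_on {1..} f" and v: "v \<in> unit_cube k" and a: "\<forall>t\<ge>1. a t \<in> {1..k}"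
    and opt: "\<forall>t\<ge>1. best_arm k v (c t) (opt t)"
    and budget: "\<forall>\<tau>\<ge>1. (\<Sum>t=1..\<tau>. regret v (c t) (opt t) (a t)) \<le> f \<tau>"
    and alg: "prediction_algorithm k f c a p" and T: "2 \<le> T"
  interpret prediction_game k f c a p v
    using mono v a alg by unfold_locales auto
  \<comment> \<open>An optimal arm attains the maximum, so at the true values \<open>pen\<close> is
    the actual regret. The agent's bound thus says that \<open>v\<close> is in every
    \<open>K t\<close>.\<close>
  have pen: "pen t v = regret v (c t) (opt t) (a t)" if "1 \<le> t" for t
  proof -
    have o: "opt t \<in> {1..k}" "\<forall>j\<in>{1..k}. v j - c t j \<le> v (opt t) - c t (opt t)"
      using opt that by (auto simp: best_arm_def is_arg_max_linorder)
    then have "Max ((\<lambda>i. v i - c t i) ` {1..k}) = v (opt t) - c t (opt t)"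
      by (intro Max_eqI) auto
    then show ?thesis by (simp add: pen_def regret_def)
  qed
  have cum: "cum l v = (\<Sum>t=1..l. regret v (c t) (opt t) (a t))" for l
    unfolding cum_def using pen by (intro sum.cong) auto
  have vK: "v \<in> K t" for t
    using v budget by (auto simp: K_iff cum)
  have fT: "0 \<le> f T" and k: "1 \<le> real k ^ 4" and ln: "1 / 2 \<le> ln (real T)"
  proof -
    have "0 \<le> cum T v" unfolding cum_def by (intro sum_nonneg pen_nonneg) auto
    also have "\<dots> \<le> f T" using budget T by (simp add: cum)
    finally show "0 \<le> f T" .
    show "1 \<le> real k ^ 4" using k_pos by (simp add: one_le_power)
    show "1 / 2 \<le> ln (real T)" by (rule half_le_ln[OF T])
  qed
  have "(\<Sum>t=1..T. regret v (c t) (opt t) (p t)) = (\<Sum>t=1..T. regret v (c t) (opt t) (a t)) + (\<Sum>t=1..T. gap t)"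
    by (simp add: sum.distrib[symmetric] regret_def gap_def algebra_simps)
  also have "\<dots> \<le> f T + 96 * real k ^ 4 * (f T + 1) * ln (real T)"
    using budget T by (intro add_mono total_gap vK) auto
  finally have "(\<Sum>t=1..T. regret v (c t) (opt t) (p t)) \<le> \<dots>" .
  \<comment> \<open>The agent's own regret accounts for the remaining 4 of the constant 100.\<close>
  moreover have "f T \<le> 4 * real k ^ 4 * (f T + 1) * ln (real T)"
  proof -
    have "1 * (1/2) \<le> real k ^ 4 * ln (real T)" using k ln by (intro mult_mono) auto
    then have "(f T + 1) * (1/2) \<le> (f T + 1) * (real k ^ 4 * ln (real T))"
      using fT by (intro mult_left_mono) auto
    then show ?thesis using fT by (simp add: algebra_simps)
  qed
  ultimately show "(\<Sum>t=1..T. regret v (c t) (opt t) (p t)) \<le> 100 * real k ^ 4 * (f T + 1) * ln (real T)"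
    by linarith
qed simp

end
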